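(* Let $1\le p<\infty$. For every non-empty set $A$, the free $p$-convex Banach lattice $FBL^{(p)}[\ell_1(A)]$ has the strong Nakano property.
   Context: All spaces are real. For a Banach space $E$ with dual $E^*$ and closed unit ball $B_E$, a function $f:E^*\to\mathbb R$ is positively homogeneous if $f(\lambda x^* )=\lambda f(x^* )$ for all $\lambda\ge 0$. For such $f$ put $$\|f\|_{FBL^{(p)}[E]}=\sup\Big\{\Big(\sum_{i=1}^m|f(x_i^* )|^p\Big)^{1/p} : m\in\mathbb N,\ x_1^*,\dots,x_m^*\in E^*,\ \sup_{x\in B_E}\sum_{i=1}^m|x_i^*(x)|^p\le 1\Big\}.$$ The positively homogeneous functions for which this is finite form a Banach lattice under this norm and the pointwise order and lattice operations, and $FBL^{(p)}[E]$ is its closed sublattice generated by the evaluations $\delta_x$, $x\in E$, where $\delta_x(x^* )=x^*(x)$. A Banach lattice $X$ has the strong Nakano property if for every norm-bounded (non-empty) upwards directed subset $D\subset X_+$ there is an upper bound $b\in X_+$ of $D$ with $\|b\|=\sup\{\|a\|:a\in D\}$. *)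

theory Defs
  imports "HOL-Analysis.Analysis" "HOL-Library.Function_Algebras"
begin

section \<open>The Banach space \<open>\<ell>\<^sub>1(A)\<close>\<close>

text \<open>The non-empty index set \<open>A\<close> is the universe of the type variable \<open>'a\<close>.\<close>

typedef 'a ell1 = "{x :: 'a \<Rightarrow> real. (\<lambda>i. \<bar>x i\<bar>) summable_on UNIV}"
  morphisms ell1_coord Abs_ell1
  by (rule exI[of _ "\<lambda>_. 0"]) simp

setup_lifting type_definition_ell1

lemma summable_ell1: "(\<lambda>i. \<bar>ell1_coord x i\<bar>) summable_on UNIV"
  using ell1_coord[of x] by simp

lemma summable_abs_add:
  fixes x y :: "'a \<Rightarrow> real"
  assumes "(\<lambda>i. \<bar>x i\<bar>) summable_on UNIV" "(\<lambda>i. \<bar>y i\<bar>) summable_on UNIV"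
  shows "(\<lambda>i. \<bar>x i + y i\<bar>) summable_on UNIV"
  by (rule summable_on_comparison_test[OF summable_on_add[OF assms]]) (auto intro: abs_triangle_ineq)

lemma summable_abs_diff:
  fixes x y :: "'a \<Rightarrow> real"
  assumes "(\<lambda>i. \<bar>x i\<bar>) summable_on UNIV" "(\<lambda>i. \<bar>y i\<bar>) summable_on UNIV"
  shows "(\<lambda>i. \<bar>x i - y i\<bar>) summable_on UNIV"
  by (rule summable_on_comparison_test[OF summable_on_add[OF assms]]) (auto intro: abs_triangle_ineq4)

instantiation ell1 :: (type) real_normed_vector
begin

lift_definition zero_ell1 :: "'a ell1" is "\<lambda>_. 0" by simp
lift_definition plus_ell1 :: "'a ell1 \<Rightarrow> 'a ell1 \<Rightarrow> 'a ell1" is "\<lambda>x y i. x i + y i"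
  by (rule summable_abs_add)
lift_definition minus_ell1 :: "'a ell1 \<Rightarrow> 'a ell1 \<Rightarrow> 'a ell1" is "\<lambda>x y i. x i - y i"
  by (rule summable_abs_diff)
lift_definition uminus_ell1 :: "'a ell1 \<Rightarrow> 'a ell1" is "\<lambda>x i. - x i" by simp
lift_definition scaleR_ell1 :: "real \<Rightarrow> 'a ell1 \<Rightarrow> 'a ell1" is "\<lambda>r x i. r * x i"
  by (simp add: abs_mult summable_on_cmult_right)
lift_definition norm_ell1 :: "'a ell1 \<Rightarrow> real" is "\<lambda>x. \<Sum>\<^sub>\<infinity>i. \<bar>x i\<bar>" .

definition dist_ell1 :: "'a ell1 \<Rightarrow> 'a ell1 \<Rightarrow> real"
  where "dist_ell1 x y = norm (x - y)"
definition [code del]: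
  "(uniformity :: ('a ell1 \<times> 'a ell1) filter) = (INF e\<in>{0 <..}. principal {(x, y). dist x y < e})"
definition open_ell1 :: "'a ell1 set \<Rightarrow> bool"
  where [code del]: "open_ell1 S = (\<forall>x\<in>S. \<forall>\<^sub>F (x', y) in uniformity. x' = x \<longrightarrow> y \<in> S)"
definition sgn_ell1 :: "'a ell1 \<Rightarrow> 'a ell1"
  where "sgn_ell1 x = scaleR (inverse (norm x)) x"

instance
proof
  fix x y z :: "'a ell1" and r s :: real
  show "x + y + z = x + (y + z)" "x + y = y + x" "0 + x = x" "- x + x = 0" "x - y = x + - y"
    "r *\<^sub>R (x + y) = r *\<^sub>R x + r *\<^sub>R y" "(r + s) *\<^sub>R x = r *\<^sub>R x + s *\<^sub>R x"
    "r *\<^sub>R s *\<^sub>R x = (r * s) *\<^sub>R x" "1 *\<^sub>R x = x"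
    by (transfer, force simp: algebra_simps)+
  show "norm x = 0 \<longleftrightarrow> x = 0"
  proof (transfer, safe)
    fix x :: "'a \<Rightarrow> real"
    assume "(\<lambda>i. \<bar>x i\<bar>) summable_on UNIV" "(\<Sum>\<^sub>\<infinity>i. \<bar>x i\<bar>) = 0"
    then have "\<bar>x i\<bar> = 0" for i
      by (intro nonneg_infsum_le_0D[where A = UNIV and f = "\<lambda>i. \<bar>x i\<bar>"]) auto
    then show "x = (\<lambda>_. 0)" by auto
  qed auto
  show "norm (x + y) \<le> norm x + norm y"
  proof transfer
    fix x y :: "'a \<Rightarrow> real"
    assume *: "(\<lambda>i. \<bar>x i\<bar>) summable_on UNIV" "(\<lambda>i. \<bar>y i\<bar>) summable_on UNIV"
    have "(\<Sum>\<^sub>\<infinity>i. \<bar>x i + y i\<bar>) \<le> (\<Sum>\<^sub>\<infinity>i. \<bar>x i\<bar> + \<bar>y i\<bar>)"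
      by (intro infsum_mono summable_abs_add summable_on_add * abs_triangle_ineq)
    also have "\<dots> = (\<Sum>\<^sub>\<infinity>i. \<bar>x i\<bar>) + (\<Sum>\<^sub>\<infinity>i. \<bar>y i\<bar>)"
      by (rule infsum_add[OF *])
    finally show "(\<Sum>\<^sub>\<infinity>i. \<bar>x i + y i\<bar>) \<le> (\<Sum>\<^sub>\<infinity>i. \<bar>x i\<bar>) + (\<Sum>\<^sub>\<infinity>i. \<bar>y i\<bar>)" .
  qed
  show "norm (r *\<^sub>R x) = \<bar>r\<bar> * norm x"
    by transfer (simp add: abs_mult infsum_cmult_right')
qed (simp_all add: dist_ell1_def uniformity_ell1_def open_ell1_def sgn_ell1_def)

end

lemma sum_abs_le_norm_ell1: "finite F \<Longrightarrow> (\<Sum>i\<in>F. \<bar>ell1_coord x i\<bar>) \<le> norm x"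
  by (simp add: norm_ell1.rep_eq finite_sum_le_infsum summable_ell1)

instance ell1 :: (type) banach
proof
  fix X :: "nat \<Rightarrow> 'a ell1"
  assume C: "Cauchy X"
  have coord: "\<bar>ell1_coord x i\<bar> \<le> norm x" for x :: "'a ell1" and i
    using sum_abs_le_norm_ell1[of "{i}" x] by simp
  have "Cauchy (\<lambda>n. ell1_coord (X n) i)" for i
  proof (rule CauchyI)
    fix e :: real assume "0 < e"
    from CauchyD[OF C this] obtain M where M: "\<forall>m\<ge>M. \<forall>n\<ge>M. norm (X m - X n) < e" by blast
    have "norm (ell1_coord (X m) i - ell1_coord (X n) i) \<le> norm (X m - X n)" for m n
      using coord[of "X m - X n" i] by (simp add: minus_ell1.rep_eq)
    with M show "\<exists>M. \<forall>m\<ge>M. \<forall>n\<ge>M. norm (ell1_coord (X m) i - ell1_coord (X n) i) < e"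
      by (meson le_less_trans)
  qed
  then have "\<exists>l. (\<lambda>n. ell1_coord (X n) i) \<longlonglongrightarrow> l" for i
    by (simp add: Cauchy_convergent_iff convergent_def)
  then obtain l where l: "\<And>i. (\<lambda>n. ell1_coord (X n) i) \<longlonglongrightarrow> l i" by metis
  have tail: "\<exists>M. \<forall>n\<ge>M. \<forall>F. finite F \<longrightarrow> (\<Sum>i\<in>F. \<bar>ell1_coord (X n) i - l i\<bar>) \<le> e"
    if "0 < e" for e
  proof -
    from CauchyD[OF C that] obtain M where M: "\<forall>m\<ge>M. \<forall>n\<ge>M. norm (X m - X n) < e" by blast
    have "(\<Sum>i\<in>F. \<bar>ell1_coord (X n) i - l i\<bar>) \<le> e" if "n \<ge> M" "finite F" for n F
    proof (rule LIMSEQ_le_const2)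
      show "(\<lambda>m. \<Sum>i\<in>F. \<bar>ell1_coord (X n) i - ell1_coord (X m) i\<bar>)
              \<longlonglongrightarrow> (\<Sum>i\<in>F. \<bar>ell1_coord (X n) i - l i\<bar>)"
        by (intro tendsto_intros l)
      have "(\<Sum>i\<in>F. \<bar>ell1_coord (X n) i - ell1_coord (X m) i\<bar>) \<le> e" if "m \<ge> M" for m
        using sum_abs_le_norm_ell1[OF \<open>finite F\<close>, of "X n - X m"] M that \<open>n \<ge> M\<close>
        by (smt (verit) minus_ell1.rep_eq sum.cong)
      then show "\<exists>N. \<forall>m\<ge>N. (\<Sum>i\<in>F. \<bar>ell1_coord (X n) i - ell1_coord (X m) i\<bar>) \<le> e" by blast
    qed
    then show ?thesis by blast
  qed
  have summ: "(\<lambda>i. \<bar>ell1_coord (X n) i - l i\<bar>) summable_on UNIV"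
    if "\<forall>F. finite F \<longrightarrow> (\<Sum>i\<in>F. \<bar>ell1_coord (X n) i - l i\<bar>) \<le> e" for n and e :: real
    using that by (intro nonneg_bdd_above_summable_on bdd_aboveI2[where M = e]) auto
  from tail[of 1] obtain n where
    "\<forall>F. finite F \<longrightarrow> (\<Sum>i\<in>F. \<bar>ell1_coord (X n) i - l i\<bar>) \<le> 1" by auto
  from summable_abs_diff[OF summable_ell1[of "X n"] summ[OF this]]
  have "(\<lambda>i. \<bar>l i\<bar>) summable_on UNIV" by simp
  then have L: "ell1_coord (Abs_ell1 l) = l" by (simp add: Abs_ell1_inverse)
  have "X \<longlonglongrightarrow> Abs_ell1 l"
  proof (rule LIMSEQ_I)
    fix e :: real assume "0 < e"
    then obtain M where M: "\<forall>n\<ge>M. \<forall>F. finite F \<longrightarrow> (\<Sum>i\<in>F. \<bar>ell1_coord (X n) i - l i\<bar>) \<le> e / 2"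
      using tail[of "e / 2"] by auto
    have "norm (X n - Abs_ell1 l) \<le> e / 2" if "n \<ge> M" for n
      unfolding norm_ell1.rep_eq minus_ell1.rep_eq L
      by (rule infsum_le_finite_sums) (use M that summ[of n "e / 2"] in blast)+
    with \<open>0 < e\<close> show "\<exists>N. \<forall>n\<ge>N. norm (X n - Abs_ell1 l) < e"
      by (intro exI[of _ M]) force
  qed
  then show "convergent X" by (auto simp: convergent_def)
qed


section \<open>The free \<open>p\<close>-convex Banach lattice over a Banach space\<close>

text \<open>The dual of \<open>'e\<close> is \<open>'e \<Rightarrow>\<^sub>L real\<close>.\<close>

definition positively_homogeneous :: "('e::banach \<Rightarrow>\<^sub>L real \<Rightarrow> real) \<Rightarrow> bool" where
  "positively_homogeneous f \<longleftrightarrow> (\<forall>c\<ge>0. \<forall>\<phi>. f (c *\<^sub>R \<phi>) = c * f \<phi>)"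

text \<open>The numbers whose supremum is the norm of \<open>f\<close>; the functionals
  \<open>x\<^sub>1\<^sup>*, \<dots>, x\<^sub>m\<^sup>*\<close> are \<open>\<phi> 0, \<dots>, \<phi> (m - 1)\<close>. The inner supremum ranges over a bounded set
  of reals, since the \<open>\<phi> i\<close> are bounded.\<close>

definition fbl_values :: "real \<Rightarrow> ('e::banach \<Rightarrow>\<^sub>L real \<Rightarrow> real) \<Rightarrow> real set" where
  "fbl_values p f =
    {(\<Sum>i<m. \<bar>f (\<phi> i)\<bar> powr p) powr (1 / p) | (m :: nat) (\<phi> :: nat \<Rightarrow> 'e \<Rightarrow>\<^sub>L real).
       (SUP x\<in>cball 0 1. \<Sum>i<m. \<bar>blinfun_apply (\<phi> i) x\<bar> powr p) \<le> 1}"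

text \<open>As \<open>Sup\<close> on the reals is unspecified for unbounded sets, \<open>fbl_norm p f\<close> is
  meaningful only for \<open>f \<in> fbl_ambient p\<close>, the functions for which the supremum is finite.\<close>

definition fbl_norm :: "real \<Rightarrow> ('e::banach \<Rightarrow>\<^sub>L real \<Rightarrow> real) \<Rightarrow> real" where
  "fbl_norm p f = Sup (fbl_values p f)"

definition fbl_ambient :: "real \<Rightarrow> ('e::banach \<Rightarrow>\<^sub>L real \<Rightarrow> real) set" where
  "fbl_ambient p = {f. positively_homogeneous f \<and> bdd_above (fbl_values p f)}"

definition evaluation :: "'e::banach \<Rightarrow> 'e \<Rightarrow>\<^sub>L real \<Rightarrow> real" where
  "evaluation x = (\<lambda>\<phi>. blinfun_apply \<phi> x)"

text \<open>Order and lattice operations on functions are the pointwise ones.\<close>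

definition closed_sublattice :: "real \<Rightarrow> ('e::banach \<Rightarrow>\<^sub>L real \<Rightarrow> real) set \<Rightarrow> bool" where
  "closed_sublattice p S \<longleftrightarrow>
     S \<subseteq> fbl_ambient p \<and> 0 \<in> S \<and>
     (\<forall>f\<in>S. \<forall>g\<in>S. f + g \<in> S \<and> sup f g \<in> S \<and> inf f g \<in> S) \<and>
     (\<forall>c. \<forall>f\<in>S. (\<lambda>\<phi>. c * f \<phi>) \<in> S) \<and>
     (\<forall>h f. (\<forall>n. h n \<in> S) \<and> f \<in> fbl_ambient p \<and> (\<lambda>n. fbl_norm p (h n - f)) \<longlonglongrightarrow> 0 \<longrightarrow> f \<in> S)"

definition FBL :: "real \<Rightarrow> ('e::banach \<Rightarrow>\<^sub>L real \<Rightarrow> real) set" where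
  "FBL p = closed_sublattice p hull range evaluation"


section \<open>The strong Nakano property\<close>

text \<open>A Banach lattice is given by its carrier \<open>X\<close>, ordered by the order of the ambient type,
  and its norm \<open>N\<close>.\<close>

definition strong_nakano :: "'b::{order, zero} set \<Rightarrow> ('b \<Rightarrow> real) \<Rightarrow> bool" where
  "strong_nakano X N \<longleftrightarrow>
     (\<forall>D. D \<subseteq> {a \<in> X. 0 \<le> a} \<and> D \<noteq> {} \<and> (\<forall>a\<in>D. \<forall>b\<in>D. \<exists>c\<in>D. a \<le> c \<and> b \<le> c) \<and>
          bdd_above (N ` D) \<longrightarrow>
        (\<exists>b\<in>X. 0 \<le> b \<and> (\<forall>a\<in>D. a \<le> b) \<and> N b = Sup (N ` D)))"

end

theory Submission
  imports Defs
begin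

text \<open>
  Let \<open>D\<close> be an upwards directed set of non-negative elements of the lattice, with norms bounded
  by \<open>C\<close>, the supremum of these norms. Write \<open>e\<^sub>a\<close> for the unit vectors of \<open>\<ell>\<^sub>1(A)\<close>. The upper bound
  of norm \<open>C\<close> has the explicit form
    \<open>b \<phi> = C (\<Sum>\<^sub>a \<mu>\<^sub>a |\<phi> e\<^sub>a|\<^sup>p)\<^sup>1\<^sup>/\<^sup>p\<close>
  for suitable weights \<open>\<mu>\<^sub>a \<ge> 0\<close> whose sum is at most \<open>1\<close>. The bound \<open>\<parallel>b\<parallel> \<le> C\<close> is then immediate, since
  exchanging the two sums in \<open>\<Sum>\<^sub>i b(\<phi>\<^sub>i)\<^sup>p\<close> leaves a \<open>\<mu>\<close>-average of the numbers \<open>\<Sum>\<^sub>i |\<phi>\<^sub>i e\<^sub>a|\<^sup>p \<le> 1\<close>;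
  and \<open>\<parallel>b\<parallel> \<ge> C\<close> holds for every upper bound of \<open>D\<close>, because the norm is monotone.

  The weights come from Pietsch's domination argument. On \<open>\<ell>\<^sub>1(A)\<close> the weak \<open>p\<close>-norm of a finite family
  of functionals is a supremum over the unit vectors only (\<open>weak_p_bound_ell1\<close>), so that \<open>\<parallel>d\<parallel> \<le> C\<close> says
  \<open>\<Sum>\<^sub>i d(\<phi>\<^sub>i)\<^sup>p \<le> C\<^sup>p sup\<^sub>a \<Sum>\<^sub>i |\<phi>\<^sub>i e\<^sub>a|\<^sup>p\<close>. A minimax theorem on the compact convex set of all weights
  (\<open>affine_minimax\<close>) exchanges the quantifiers: one \<open>\<mu>\<close> serves all functionals. Directedness
  lets this \<open>\<mu>\<close> serve all \<open>d \<in> D\<close> too, as finitely many \<open>d\<close> can be replaced by a common upper bound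
  (\<open>directed_Pietsch_domination\<close>).

  The set of weights is compact for pointwise convergence, for which the infinite sum defining \<open>b\<close>
  is not continuous: without further care mass of \<open>\<mu>\<close> would escape to infinity. Therefore the
  domination is only asked for functionals that live on finitely many coordinates. It extends to all
  functionals because every element of the lattice is continuous along the truncations
  of a functional to finite sets of coordinates (\<open>FBL_restrict_tendsto\<close>); this is a weak form of weak-star
  continuity on bounded sets, and it survives norm limits.

  Finally \<open>b\<close> belongs to the lattice. For finitely supported \<open>\<mu>\<close> this needs that \<open>(s\<^sup>p + t\<^sup>p)\<^sup>1\<^sup>/\<^sup>p\<close> is, up to
  \<open>\<epsilon>(s + t)\<close>, a maximum of finitely many linear forms (\<open>p_norm2_finite_approximation\<close>). In general the tails of the
  series have norm at most the \<open>p\<close>-th root of the remaining mass, so \<open>b\<close> is a norm limit of such functions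
  (\<open>weighted_p_norm_in_FBL\<close>).
\<close>

section \<open>A minimax theorem and the compact set of weights\<close>

text \<open>The pairs of values form a compact convex subset of the plane. Were it disjoint from the
  quadrant of non-negative pairs, a separating line would give weights that contradict the hypothesis.
  Convexity of \<open>M\<close> enters only through the values, so that \<open>M\<close> may lie in a space without a linear structure.\<close>

lemma affine_minimax_two:
  fixes u v :: "'m::topological_space \<Rightarrow> real"
  assumes "compact M" "continuous_on M u" "continuous_on M v"
    and affine: "\<And>x y t. x \<in> M \<Longrightarrow> y \<in> M \<Longrightarrow> 0 \<le> t \<Longrightarrow> t \<le> 1 \<Longrightarrow>
      \<exists>z\<in>M. u z = (1 - t) * u x + t * u y \<and> v z = (1 - t) * v x + t * v y"
    and weights: "\<And>\<alpha> \<beta>. 0 \<le> \<alpha> \<Longrightarrow> 0 \<le> \<beta> \<Longrightarrow> \<exists>x\<in>M. 0 \<le> \<alpha> * u x + \<beta> * v x"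
  shows "\<exists>x\<in>M. 0 \<le> u x \<and> 0 \<le> v x"
proof (rule ccontr)
  assume neg: "\<not> ?thesis"
  let ?S = "(\<lambda>x. (u x, v x)) ` M" and ?T = "{0::real..} \<times> {0::real..}"
  have "convex ?S"
    unfolding convex_alt
  proof (intro ballI allI impI)
    fix a b t assume "a \<in> ?S" "b \<in> ?S" and t: "0 \<le> t \<and> t \<le> (1::real)"
    then obtain x y where "x \<in> M" "y \<in> M" "a = (u x, v x)" "b = (u y, v y)" by blast
    with affine[of x y t] t show "(1 - t) *\<^sub>R a + t *\<^sub>R b \<in> ?S" by force
  qed
  moreover have "compact ?S"
    by (intro compact_continuous_image continuous_on_Pair assms)
  moreover have "?S \<noteq> {}" using weights[of 0 0] by auto
  moreover have "convex ?T" "closed ?T" by (intro convex_Times closed_Times; simp)+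
  moreover have "?S \<inter> ?T = {}" using neg by auto
  ultimately obtain w c where "\<And>z. z \<in> ?S \<Longrightarrow> w \<bullet> z < c" and "\<And>z. z \<in> ?T \<Longrightarrow> c < w \<bullet> z"
    using separating_hyperplane_compact_closed[of ?S ?T] by metis
  moreover obtain \<alpha> \<beta> where w: "w = (\<alpha>, \<beta>)" by (cases w)
  ultimately have below: "\<And>x. x \<in> M \<Longrightarrow> \<alpha> * u x + \<beta> * v x < c"
    and above: "\<And>r s. 0 \<le> r \<Longrightarrow> 0 \<le> s \<Longrightarrow> c < \<alpha> * r + \<beta> * s"
    by (force simp: inner_Pair)+
  have "c < 0" using above[of 0 0] by simp
  \<comment> \<open>A linear form bounded below on the quadrant has non-negative coefficients.\<close>
  have "0 \<le> \<alpha>"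
  proof (rule ccontr)
    assume "\<not> 0 \<le> \<alpha>"
    with above[of "c / \<alpha>" 0] \<open>c < 0\<close> show False by (simp add: divide_nonpos_neg)
  qed
  moreover have "0 \<le> \<beta>"
  proof (rule ccontr)
    assume "\<not> 0 \<le> \<beta>"
    with above[of 0 "c / \<beta>"] \<open>c < 0\<close> show False by (simp add: divide_nonpos_neg)
  qed
  ultimately obtain x where "x \<in> M" "0 \<le> \<alpha> * u x + \<beta> * v x" using weights by blast
  with below[of x] \<open>c < 0\<close> show False by simp
qed

text \<open>Kneser's induction: the constraint with index \<open>k\<close> is absorbed into \<open>M\<close>, and the case of two
  functions, one of them a weighted sum of the remaining ones, shows that the smaller set inherits the hypothesis on weights.\<close>

lemma affine_minimax_finite:
  fixes u :: "'j \<Rightarrow> 'm::topological_space \<Rightarrow> real"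
  assumes "finite J" "compact M"
    and "\<And>j. j \<in> J \<Longrightarrow> continuous_on UNIV (u j)"
    and "\<And>x y t. x \<in> M \<Longrightarrow> y \<in> M \<Longrightarrow> 0 \<le> t \<Longrightarrow> t \<le> 1 \<Longrightarrow>
      \<exists>z\<in>M. \<forall>j\<in>J. u j z = (1 - t) * u j x + t * u j y"
    and "\<And>l. (\<And>j. 0 \<le> l j) \<Longrightarrow> \<exists>x\<in>M. 0 \<le> (\<Sum>j\<in>J. l j * u j x)"
  shows "\<exists>x\<in>M. \<forall>j\<in>J. 0 \<le> u j x"
  using assms
proof (induction J arbitrary: M rule: finite_induct)
  case empty
  then show ?case using empty(4)[of "\<lambda>_. 0"] by auto
next
  case (insert k J)
  note cont = insert.prems(2) and affine = insert.prems(3) and weights = insert.prems(4)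
  let ?M = "M \<inter> {x. 0 \<le> u k x}"
  have cpt: "compact ?M"
    using cont[of k] by (intro compact_Int_closed \<open>compact M\<close> closed_Collect_le) auto
  have "\<exists>x\<in>?M. \<forall>j\<in>J. 0 \<le> u j x"
  proof (rule insert.IH[OF cpt])
    show "continuous_on UNIV (u j)" if "j \<in> J" for j
      using cont[of j] that by simp
    show "\<exists>z\<in>?M. \<forall>j\<in>J. u j z = (1 - t) * u j x + t * u j y"
      if "x \<in> ?M" "y \<in> ?M" "0 \<le> t" "t \<le> 1" for x y t
      using affine[of x y t] that by auto
    fix l :: "'j \<Rightarrow> real" assume l: "\<And>j. 0 \<le> l j"
    define v where "v x = (\<Sum>j\<in>J. l j * u j x)" for x
    have "\<exists>x\<in>M. 0 \<le> u k x \<and> 0 \<le> v x"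
    proof (rule affine_minimax_two[OF \<open>compact M\<close>])
      show "continuous_on M (u k)" "continuous_on M v"
        unfolding v_def using cont continuous_on_subset[OF _ subset_UNIV]
        by (auto intro!: continuous_intros)
      show "\<exists>z\<in>M. u k z = (1 - t) * u k x + t * u k y \<and> v z = (1 - t) * v x + t * v y"
        if t: "x \<in> M" "y \<in> M" "0 \<le> t" "t \<le> 1" for x y t
      proof -
        obtain z where z: "z \<in> M" "\<forall>j\<in>insert k J. u j z = (1 - t) * u j x + t * u j y"
          using affine[OF t] by blast
        have "v z = (\<Sum>j\<in>J. (1 - t) * (l j * u j x) + t * (l j * u j y))"
          unfolding v_def
        proof (intro sum.cong refl)
          fix j assume "j \<in> J"
          with z(2) have "u j z = (1 - t) * u j x + t * u j y" by blast
          then show "l j * u j z = (1 - t) * (l j * u j x) + t * (l j * u j y)"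
            by (simp only: distrib_left mult.left_commute)
        qed
        with z show ?thesis
          by (intro bexI[of _ z]) (auto simp: v_def sum.distrib sum_distrib_left)
      qed
      show "\<exists>x\<in>M. 0 \<le> \<alpha> * u k x + \<beta> * v x" if "0 \<le> \<alpha>" "0 \<le> \<beta>" for \<alpha> \<beta>
      proof -
        let ?l = "\<lambda>j. if j = k then \<alpha> else \<beta> * l j"
        have "(\<Sum>j\<in>insert k J. ?l j * u j x) = \<alpha> * u k x + \<beta> * v x" for x
        proof -
          have "(\<Sum>j\<in>J. ?l j * u j x) = (\<Sum>j\<in>J. \<beta> * (l j * u j x))"
            using \<open>k \<notin> J\<close> by (intro sum.cong) (auto simp: mult.assoc)
          with \<open>finite J\<close> \<open>k \<notin> J\<close> show ?thesis by (simp add: v_def sum_distrib_left)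
        qed
        with weights[of ?l] l that show ?thesis by auto
      qed
    qed
    then show "\<exists>x\<in>?M. 0 \<le> (\<Sum>j\<in>J. l j * u j x)" by (auto simp: v_def)
  qed
  then show ?case by auto
qed

text \<open>By compactness, infinitely many constraints can be met at once if any finitely many can.\<close>

lemma affine_minimax:
  fixes u :: "'j \<Rightarrow> 'm::topological_space \<Rightarrow> real"
  assumes M: "compact M"
    and cont: "\<And>j. j \<in> J \<Longrightarrow> continuous_on UNIV (u j)"
    and affine: "\<And>x y t. x \<in> M \<Longrightarrow> y \<in> M \<Longrightarrow> 0 \<le> t \<Longrightarrow> t \<le> 1 \<Longrightarrow>
      \<exists>z\<in>M. \<forall>j\<in>J. u j z = (1 - t) * u j x + t * u j y"
    and weights: "\<And>J' l. finite J' \<Longrightarrow> J' \<subseteq> J \<Longrightarrow> (\<And>j. 0 \<le> l j) \<Longrightarrow> \<exists>x\<in>M. 0 \<le> (\<Sum>j\<in>J'. l j * u j x)"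
  shows "\<exists>x\<in>M. \<forall>j\<in>J. 0 \<le> u j x"
proof -
  have "M \<inter> (\<Inter>j\<in>J. {x. 0 \<le> u j x}) \<noteq> {}"
  proof (rule compact_imp_fip_image[OF M])
    show "closed {x. 0 \<le> u j x}" if "j \<in> J" for j
      using cont[OF that] by (intro closed_Collect_le) auto
    show "M \<inter> (\<Inter>j\<in>J'. {x. 0 \<le> u j x}) \<noteq> {}" if "finite J'" "J' \<subseteq> J" for J'
    proof -
      have "\<exists>x\<in>M. \<forall>j\<in>J'. 0 \<le> u j x"
      proof (rule affine_minimax_finite[OF that(1) M])
        show "continuous_on UNIV (u j)" if "j \<in> J'" for j
          using cont \<open>J' \<subseteq> J\<close> that by blast
        show "\<exists>z\<in>M. \<forall>j\<in>J'. u j z = (1 - t) * u j x + t * u j y"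
          if "x \<in> M" "y \<in> M" "0 \<le> t" "t \<le> 1" for x y t
          using affine[OF that] \<open>J' \<subseteq> J\<close> by blast
        show "\<exists>x\<in>M. 0 \<le> (\<Sum>j\<in>J'. l j * u j x)" if "\<And>j. 0 \<le> l j" for l
          using weights[OF \<open>finite J'\<close> \<open>J' \<subseteq> J\<close>] that by blast
      qed
      then show ?thesis by auto
    qed
  qed
  then show ?thesis by auto
qed

text \<open>Total mass at most \<open>1\<close>, not equal to \<open>1\<close>: the latter condition is not closed under pointwise
  limits when the index set is infinite.\<close>

definition subprobability_weights :: "('a \<Rightarrow> real) set" where
  "subprobability_weights = {\<mu>. (\<forall>a. 0 \<le> \<mu> a) \<and> (\<forall>F. finite F \<longrightarrow> sum \<mu> F \<le> 1)}"

lemma compact_subprobability_weights: "compact (subprobability_weights :: ('a \<Rightarrow> real) set)"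
proof -
  have "compactin (product_topology (\<lambda>_. euclidean) UNIV) (PiE UNIV (\<lambda>_::'a. {0..1::real}))"
    by (simp add: compactin_PiE)
  then have "compact (PiE UNIV (\<lambda>_::'a. {0..1::real}))"
    by (simp add: euclidean_product_topology)
  moreover have "closed {\<mu>::'a \<Rightarrow> real. sum \<mu> F \<le> 1}" for F
    by (intro closed_Collect_le continuous_intros continuous_on_product_coordinates)
  then have "closed (\<Inter>F\<in>Collect finite. {\<mu>::'a \<Rightarrow> real. sum \<mu> F \<le> 1})" by blast
  moreover have "\<mu> a \<le> 1" if "\<forall>F. finite F \<longrightarrow> sum \<mu> F \<le> 1" for \<mu> :: "'a \<Rightarrow> real" and a
    using that[rule_format, of "{a}"] by simp
  then have "subprobability_weights =
      PiE UNIV (\<lambda>_::'a. {0..1::real}) \<inter> (\<Inter>F\<in>Collect finite. {\<mu>. sum \<mu> F \<le> 1})"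
    by (auto simp: subprobability_weights_def)
  ultimately show ?thesis using compact_Int_closed by metis
qed

section \<open>The norm and the lattice of functions of finite norm\<close>

lemma powr_add_superadditive:
  fixes s t p :: real
  assumes "1 \<le> p" "0 \<le> s" "0 \<le> t"
  shows "s powr p + t powr p \<le> (s + t) powr p"
proof -
  have split: "r powr p = r * r powr (p - 1)" if "0 \<le> r" for r :: real
    using powr_mult_base[OF that, of "p - 1"] by simp
  have "s powr (p - 1) \<le> (s + t) powr (p - 1)" "t powr (p - 1) \<le> (s + t) powr (p - 1)"
    using assms by (intro powr_mono2; simp)+
  then have "s * s powr (p - 1) + t * t powr (p - 1)
      \<le> s * (s + t) powr (p - 1) + t * (s + t) powr (p - 1)"
    using assms by (intro add_mono mult_left_mono) auto
  with split[of s] split[of t] split[of "s + t"] assms show ?thesis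
    by (simp add: algebra_simps)
qed

lemma powr_le_powr_cancel:
  fixes a b p :: real
  assumes "0 < p" "0 \<le> b" "a powr p \<le> b powr p"
  shows "a \<le> b"
  using assms powr_less_mono2[of p b a] by fastforce

lemma powr_inverse_le_iff:
  fixes a b p :: real
  assumes "0 < p" "0 \<le> a" "0 \<le> b"
  shows "a powr (1 / p) \<le> b \<longleftrightarrow> a \<le> b powr p"
proof
  assume "a powr (1 / p) \<le> b"
  then have "(a powr (1 / p)) powr p \<le> b powr p" using assms by (intro powr_mono2) auto
  then show "a \<le> b powr p" using assms by (simp add: powr_powr)
next
  assume "a \<le> b powr p"
  then have "a powr (1 / p) \<le> (b powr p) powr (1 / p)" using assms by (intro powr_mono2) auto
  then show "a powr (1 / p) \<le> b" using assms by (simp add: powr_powr)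
qed

text \<open>Arbitrary index sets and bounds other than \<open>1\<close> are needed because the families in the domination
  argument are indexed by constraints and are not normalised.\<close>

definition weak_p_bound ::
  "real \<Rightarrow> real \<Rightarrow> 'i set \<Rightarrow> ('i \<Rightarrow> 'e::banach \<Rightarrow>\<^sub>L real) \<Rightarrow> bool" where
  "weak_p_bound p W I \<phi> \<longleftrightarrow> (\<forall>x. norm x \<le> 1 \<longrightarrow> (\<Sum>i\<in>I. \<bar>blinfun_apply (\<phi> i) x\<bar> powr p) \<le> W)"

text \<open>The assertion \<open>\<parallel>f\<parallel> \<le> K\<close> with the \<open>p\<close>-th roots cleared, so that it is meaningful also for functions
  of infinite norm.\<close>

definition fbl_bound :: "real \<Rightarrow> real \<Rightarrow> ('e::banach \<Rightarrow>\<^sub>L real \<Rightarrow> real) \<Rightarrow> bool" where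
  "fbl_bound p K f \<longleftrightarrow> 0 \<le> K \<and>
     (\<forall>(m::nat) \<phi>. weak_p_bound p 1 {..<m} \<phi> \<longrightarrow> (\<Sum>i<m. \<bar>f (\<phi> i)\<bar> powr p) \<le> K powr p)"

lemma SUP_le_iff_weak_p_bound:
  fixes \<phi> :: "nat \<Rightarrow> 'e::banach \<Rightarrow>\<^sub>L real"
  assumes "1 \<le> p"
  shows "(SUP x\<in>cball 0 1. \<Sum>i<m. \<bar>blinfun_apply (\<phi> i) x\<bar> powr p) \<le> 1 \<longleftrightarrow>
    weak_p_bound p 1 {..<m} \<phi>"
proof -
  have "(\<Sum>i<m. \<bar>blinfun_apply (\<phi> i) x\<bar> powr p) \<le> (\<Sum>i<m. norm (\<phi> i) powr p)"
    if "x \<in> cball 0 1" for x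
  proof (intro sum_mono powr_mono2)
    fix i
    have "\<bar>blinfun_apply (\<phi> i) x\<bar> \<le> norm (\<phi> i) * norm x"
      using norm_blinfun[of "\<phi> i" x] by simp
    also have "\<dots> \<le> norm (\<phi> i)" using that by (simp add: mult_left_le)
    finally show "\<bar>blinfun_apply (\<phi> i) x\<bar> \<le> norm (\<phi> i)" .
  qed (use assms in auto)
  then have "bdd_above ((\<lambda>x. \<Sum>i<m. \<bar>blinfun_apply (\<phi> i) x\<bar> powr p) ` cball 0 1)"
    by (rule bdd_aboveI2)
  then show ?thesis
    by (subst cSUP_le_iff) (auto simp: weak_p_bound_def)
qed

lemma fbl_bound_iff_values:
  assumes "1 \<le> p"
  shows "fbl_bound p K f \<longleftrightarrow> 0 \<le> K \<and> (\<forall>v\<in>fbl_values p f. v \<le> K)"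
proof (cases "0 \<le> K")
  case True
  then have "(\<Sum>i<m. \<bar>f (\<phi> i)\<bar> powr p) powr (1 / p) \<le> K \<longleftrightarrow> (\<Sum>i<m. \<bar>f (\<phi> i)\<bar> powr p) \<le> K powr p"
    for m :: nat and \<phi>
    using assms by (intro powr_inverse_le_iff sum_nonneg) auto
  then show ?thesis
    using True unfolding fbl_bound_def fbl_values_def SUP_le_iff_weak_p_bound[OF assms] by blast
qed (auto simp: fbl_bound_def)

lemma zero_in_fbl_values: "0 \<in> fbl_values p f"
  unfolding fbl_values_def by (rule CollectI, intro exI[of _ 0] conjI) auto

lemma fbl_ambient_iff:
  assumes "1 \<le> p"
  shows "f \<in> fbl_ambient p \<longleftrightarrow> positively_homogeneous f \<and> (\<exists>K. fbl_bound p K f)"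
proof
  assume "f \<in> fbl_ambient p"
  then obtain K where "positively_homogeneous f" "\<forall>v\<in>fbl_values p f. v \<le> K"
    by (auto simp: fbl_ambient_def bdd_above_def)
  moreover from this(2) zero_in_fbl_values have "0 \<le> K" by blast
  ultimately show "positively_homogeneous f \<and> (\<exists>K. fbl_bound p K f)"
    using fbl_bound_iff_values[OF assms] by blast
next
  assume "positively_homogeneous f \<and> (\<exists>K. fbl_bound p K f)"
  then show "f \<in> fbl_ambient p"
    using fbl_bound_iff_values[OF assms] by (auto simp: fbl_ambient_def bdd_above_def)
qed

lemma fbl_bound_norm:
  assumes "1 \<le> p" "f \<in> fbl_ambient p"
  shows "fbl_bound p (fbl_norm p f) f"
proof -
  have "bdd_above (fbl_values p f)" using assms(2) by (simp add: fbl_ambient_def)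
  then have "\<forall>v\<in>fbl_values p f. v \<le> fbl_norm p f" by (auto simp: fbl_norm_def intro: cSup_upper)
  then show ?thesis using fbl_bound_iff_values[OF assms(1)] zero_in_fbl_values by blast
qed

lemma fbl_norm_le:
  assumes "1 \<le> p" "fbl_bound p K f"
  shows "fbl_norm p f \<le> K"
  unfolding fbl_norm_def
  using fbl_bound_iff_values[OF assms(1)] assms(2) zero_in_fbl_values
  by (intro cSup_least) blast+

lemma fbl_norm_nonneg:
  assumes "1 \<le> p" "f \<in> fbl_ambient p"
  shows "0 \<le> fbl_norm p f"
  using fbl_bound_norm[OF assms] by (simp add: fbl_bound_def)

lemma fbl_bound_mono:
  assumes "0 \<le> p" "fbl_bound p K g" "\<And>\<phi>. \<bar>f \<phi>\<bar> \<le> \<bar>g \<phi>\<bar>"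
  shows "fbl_bound p K f"
proof -
  have "(\<Sum>i<m. \<bar>f (\<phi> i)\<bar> powr p) \<le> (\<Sum>i<m. \<bar>g (\<phi> i)\<bar> powr p)" for m :: nat and \<phi>
    using assms by (intro sum_mono powr_mono2) auto
  then show ?thesis using assms(2) unfolding fbl_bound_def by (meson order_trans)
qed

lemma fbl_bound_cmult:
  assumes "fbl_bound p K f"
  shows "fbl_bound p (\<bar>c\<bar> * K) (\<lambda>\<phi>. c * f \<phi>)"
proof -
  have "(\<Sum>i<m. \<bar>c * f (\<phi> i)\<bar> powr p) = \<bar>c\<bar> powr p * (\<Sum>i<m. \<bar>f (\<phi> i)\<bar> powr p)"
    for m :: nat and \<phi>
    by (simp add: abs_mult powr_mult sum_distrib_left)
  then show ?thesis
    using assms by (auto simp: fbl_bound_def powr_mult intro!: mult_left_mono)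
qed

text \<open>The norm in fact satisfies the triangle inequality. The factor \<open>2\<close> is harmless
  where only finiteness matters, and it avoids Minkowski's inequality.\<close>

lemma fbl_bound_add:
  assumes "1 \<le> p" "fbl_bound p K f" "fbl_bound p L g"
  shows "fbl_bound p (2 * (K + L)) (\<lambda>\<phi>. \<bar>f \<phi>\<bar> + \<bar>g \<phi>\<bar>)"
  unfolding fbl_bound_def
proof (intro conjI allI impI)
  show "0 \<le> 2 * (K + L)" using assms by (simp add: fbl_bound_def)
  fix m :: nat and \<phi> :: "nat \<Rightarrow> 'a \<Rightarrow>\<^sub>L real"
  assume w: "weak_p_bound p 1 {..<m} \<phi>"
  have pt: "(\<bar>a\<bar> + \<bar>b\<bar>) powr p \<le> 2 powr p * (\<bar>a\<bar> powr p + \<bar>b\<bar> powr p)" for a b :: real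
  proof -
    have "(\<bar>a\<bar> + \<bar>b\<bar>) powr p \<le> (2 * max \<bar>a\<bar> \<bar>b\<bar>) powr p"
      using assms by (intro powr_mono2) auto
    also have "\<dots> = 2 powr p * max \<bar>a\<bar> \<bar>b\<bar> powr p" by (simp add: powr_mult)
    also have "\<dots> \<le> 2 powr p * (\<bar>a\<bar> powr p + \<bar>b\<bar> powr p)"
      by (intro mult_left_mono) (auto simp: max_def)
    finally show ?thesis .
  qed
  have "(\<Sum>i<m. \<bar>\<bar>f (\<phi> i)\<bar> + \<bar>g (\<phi> i)\<bar>\<bar> powr p)
      \<le> (\<Sum>i<m. 2 powr p * (\<bar>f (\<phi> i)\<bar> powr p + \<bar>g (\<phi> i)\<bar> powr p))"
    using pt by (intro sum_mono) simp
  also have "\<dots> = 2 powr p * ((\<Sum>i<m. \<bar>f (\<phi> i)\<bar> powr p) + (\<Sum>i<m. \<bar>g (\<phi> i)\<bar> powr p))"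
    by (simp only: distrib_left sum.distrib sum_distrib_left)
  also have "\<dots> \<le> 2 powr p * (K powr p + L powr p)"
    using assms(2,3) w by (intro mult_left_mono add_mono) (auto simp: fbl_bound_def)
  also have "\<dots> \<le> 2 powr p * (K + L) powr p"
    using assms by (intro mult_left_mono powr_add_superadditive) (auto simp: fbl_bound_def)
  also have "\<dots> = (2 * (K + L)) powr p"
    by (simp only: powr_mult)
  finally show "(\<Sum>i<m. \<bar>\<bar>f (\<phi> i)\<bar> + \<bar>g (\<phi> i)\<bar>\<bar> powr p) \<le> (2 * (K + L)) powr p" .
qed

text \<open>Positive homogeneity rescales a family of weak bound \<open>W\<close> to weak bound \<open>1\<close>. As \<open>W = 0\<close> cannot be
  rescaled, the estimate is first proved for every positive \<open>V \<ge> W\<close>.\<close>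

lemma fbl_bound_finite_family:
  fixes \<phi> :: "'i \<Rightarrow> 'e::banach \<Rightarrow>\<^sub>L real"
  assumes p: "1 \<le> p" and f: "positively_homogeneous f" "fbl_bound p K f"
    and I: "finite I" and w: "weak_p_bound p W I \<phi>"
  shows "(\<Sum>i\<in>I. \<bar>f (\<phi> i)\<bar> powr p) \<le> K powr p * W"
proof -
  have hom: "f (c *\<^sub>R \<psi>) = c * f \<psi>" if "0 \<le> c" for c \<psi>
    using f(1) that by (simp add: positively_homogeneous_def)
  have unit: "(\<Sum>i\<in>I. \<bar>f (\<psi> i)\<bar> powr p) \<le> K powr p" if "weak_p_bound p 1 I \<psi>" for \<psi>
  proof -
    obtain h where h: "bij_betw h {..<card I} I"
      using I by (metis atLeast0LessThan ex_bij_betw_nat_finite)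
    have re: "(\<Sum>i<card I. G (h i)) = (\<Sum>i\<in>I. G i)" for G :: "'i \<Rightarrow> real"
      by (rule sum.reindex_bij_betw[OF h])
    have "weak_p_bound p 1 {..<card I} (\<psi> \<circ> h)"
      unfolding weak_p_bound_def
    proof (intro allI impI)
      fix x :: 'e assume "norm x \<le> 1"
      with that re[of "\<lambda>i. \<bar>blinfun_apply (\<psi> i) x\<bar> powr p"]
      show "(\<Sum>i<card I. \<bar>blinfun_apply ((\<psi> \<circ> h) i) x\<bar> powr p) \<le> 1"
        by (simp add: weak_p_bound_def)
    qed
    with f(2) re[of "\<lambda>i. \<bar>f (\<psi> i)\<bar> powr p"] show ?thesis
      unfolding fbl_bound_def by fastforce
  qed
  have pos: "(\<Sum>i\<in>I. \<bar>f (\<phi> i)\<bar> powr p) \<le> K powr p * V" if "W \<le> V" "0 < V" for V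
  proof -
    define c where "c = V powr (- (1 / p))"
    have "c powr p = V powr (- (1 / p) * p)" by (simp only: c_def powr_powr)
    also have "- (1 / p) * p = - 1" using p by simp
    finally have c: "0 < c" "c powr p = 1 / V"
      using that by (auto simp: c_def powr_minus_divide)
    have "weak_p_bound p 1 I (\<lambda>i. c *\<^sub>R \<phi> i)"
      unfolding weak_p_bound_def
    proof (intro allI impI)
      fix x :: 'e assume "norm x \<le> 1"
      with w have "(\<Sum>i\<in>I. \<bar>blinfun_apply (\<phi> i) x\<bar> powr p) \<le> V"
        using \<open>W \<le> V\<close> by (force simp: weak_p_bound_def)
      moreover have "(\<Sum>i\<in>I. \<bar>blinfun_apply (c *\<^sub>R \<phi> i) x\<bar> powr p) =
          1 / V * (\<Sum>i\<in>I. \<bar>blinfun_apply (\<phi> i) x\<bar> powr p)"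
        using c by (simp add: scaleR_blinfun.rep_eq abs_mult powr_mult sum_distrib_left)
      ultimately show "(\<Sum>i\<in>I. \<bar>blinfun_apply (c *\<^sub>R \<phi> i) x\<bar> powr p) \<le> 1"
        using \<open>0 < V\<close> by (simp only:) (simp add: divide_simps)
    qed
    from unit[OF this] have "1 / V * (\<Sum>i\<in>I. \<bar>f (\<phi> i)\<bar> powr p) \<le> K powr p"
      using c by (simp add: hom abs_mult powr_mult sum_distrib_left)
    with \<open>0 < V\<close> show ?thesis by (simp add: divide_simps mult.commute)
  qed
  have "0 \<le> W"
    using w[unfolded weak_p_bound_def, rule_format, of 0] by (simp add: blinfun.zero_right)
  show ?thesis
  proof (rule field_le_epsilon)
    fix e :: real assume "0 < e"
    define V where "V = W + e / (K powr p + 1)"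
    have k: "0 < K powr p + 1" by (simp add: add_nonneg_pos)
    with \<open>0 < e\<close> \<open>0 \<le> W\<close> have "W \<le> V" "0 < V" by (auto simp: V_def intro: add_nonneg_pos)
    from pos[OF this] have "(\<Sum>i\<in>I. \<bar>f (\<phi> i)\<bar> powr p) \<le> K powr p * W + K powr p * (e / (K powr p + 1))"
      by (simp add: V_def distrib_left)
    also have "K powr p * (e / (K powr p + 1)) \<le> e"
      using k \<open>0 < e\<close> by (simp add: field_simps)
    finally show "(\<Sum>i\<in>I. \<bar>f (\<phi> i)\<bar> powr p) \<le> K powr p * W + e" by simp
  qed
qed

text \<open>A single functional is a family of weak bound \<open>\<parallel>\<phi>\<parallel>\<^sup>p\<close>. Hence convergence in the lattice norm
  is uniform on bounded sets of functionals.\<close>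

lemma fbl_bound_pointwise:
  assumes p: "1 \<le> p" and f: "positively_homogeneous f" "fbl_bound p K f"
  shows "\<bar>f \<phi>\<bar> \<le> K * norm \<phi>"
proof -
  have "weak_p_bound p (norm \<phi> powr p) {()} (\<lambda>_. \<phi>)"
    unfolding weak_p_bound_def
  proof (intro allI impI)
    fix x :: 'a assume "norm x \<le> 1"
    then have "\<bar>blinfun_apply \<phi> x\<bar> \<le> norm \<phi>"
      using norm_blinfun[of \<phi> x] mult_left_le[of "norm x" "norm \<phi>"] by simp
    then show "(\<Sum>i\<in>{()}. \<bar>blinfun_apply \<phi> x\<bar> powr p) \<le> norm \<phi> powr p"
      using p by (simp add: powr_mono2)
  qed
  from fbl_bound_finite_family[OF p f _ this]
  have "\<bar>f \<phi>\<bar> powr p \<le> (K * norm \<phi>) powr p"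
    using f(2) by (simp add: powr_mult fbl_bound_def)
  moreover have "0 < p" "0 \<le> K * norm \<phi>" using p f(2) by (auto simp: fbl_bound_def)
  ultimately show ?thesis using powr_le_powr_cancel by blast
qed

lemma evaluation_in_fbl_ambient:
  assumes p: "1 \<le> p"
  shows "evaluation x \<in> fbl_ambient p"
  unfolding fbl_ambient_iff[OF p]
proof (intro conjI exI)
  show "positively_homogeneous (evaluation x)"
    by (simp add: positively_homogeneous_def evaluation_def scaleR_blinfun.rep_eq)
  show "fbl_bound p (norm x) (evaluation x)"
    unfolding fbl_bound_def
  proof (intro conjI allI impI)
    fix m :: nat and \<phi> :: "nat \<Rightarrow> 'a \<Rightarrow>\<^sub>L real"
    assume "weak_p_bound p 1 {..<m} \<phi>"
    moreover define u where "u = x /\<^sub>R norm x"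
    moreover have "norm u \<le> 1" by (cases "x = 0") (simp_all add: u_def)
    ultimately have "(\<Sum>i<m. \<bar>blinfun_apply (\<phi> i) u\<bar> powr p) \<le> 1"
      by (simp only: weak_p_bound_def)
    moreover have "x = norm x *\<^sub>R u" by (cases "x = 0") (simp_all add: u_def)
    then have "blinfun_apply (\<phi> i) x = norm x * blinfun_apply (\<phi> i) u" for i
      by (metis blinfun.scaleR_right real_scaleR_def)
    ultimately show "(\<Sum>i<m. \<bar>evaluation x (\<phi> i)\<bar> powr p) \<le> norm x powr p"
      by (simp add: evaluation_def abs_mult powr_mult flip: sum_distrib_left)
        (simp add: mult_left_le)
  qed simp
qed

lemma fbl_ambient_dominated:
  assumes p: "1 \<le> p" and "f \<in> fbl_ambient p" "g \<in> fbl_ambient p" "positively_homogeneous h"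
    and "\<And>\<phi>. \<bar>h \<phi>\<bar> \<le> \<bar>f \<phi>\<bar> + \<bar>g \<phi>\<bar>"
  shows "h \<in> fbl_ambient p"
proof -
  obtain K L where "fbl_bound p K f" "fbl_bound p L g"
    using assms(2,3) unfolding fbl_ambient_iff[OF p] by blast
  from fbl_bound_add[OF p this] have "fbl_bound p (2 * (K + L)) h"
    by (rule fbl_bound_mono[rotated]) (use p assms(5) in auto)
  with assms(4) show ?thesis unfolding fbl_ambient_iff[OF p] by blast
qed

lemma fbl_ambient_lattice_closed:
  assumes p: "1 \<le> p" and f: "f \<in> fbl_ambient p" and g: "g \<in> fbl_ambient p"
  shows "f + g \<in> fbl_ambient p" "f - g \<in> fbl_ambient p"
    "sup f g \<in> fbl_ambient p" "inf f g \<in> fbl_ambient p"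
proof -
  have hom: "\<And>c \<phi>. 0 \<le> c \<Longrightarrow> f (c *\<^sub>R \<phi>) = c * f \<phi>" "\<And>c \<phi>. 0 \<le> c \<Longrightarrow> g (c *\<^sub>R \<phi>) = c * g \<phi>"
    using f g by (auto simp: fbl_ambient_def positively_homogeneous_def)
  show "f + g \<in> fbl_ambient p" "f - g \<in> fbl_ambient p"
    by (rule fbl_ambient_dominated[OF p f g]; auto simp: positively_homogeneous_def hom algebra_simps)+
  have "max (c * a) (c * b) = c * max a b \<and> min (c * a) (c * b) = c * min a b"
    if "0 \<le> c" for a b c :: real
    using that by (cases "a \<le> b") (simp_all add: max_absorb1 max_absorb2 min_absorb1 min_absorb2 mult_left_mono)
  then have "positively_homogeneous (sup f g)" "positively_homogeneous (inf f g)"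
    unfolding positively_homogeneous_def
    by (simp_all add: hom sup_real_def inf_real_def)
  moreover have "\<bar>sup f g \<phi>\<bar> \<le> \<bar>f \<phi>\<bar> + \<bar>g \<phi>\<bar>" "\<bar>inf f g \<phi>\<bar> \<le> \<bar>f \<phi>\<bar> + \<bar>g \<phi>\<bar>" for \<phi>
    by (auto simp: sup_real_def inf_real_def max_def min_def)
  ultimately show "sup f g \<in> fbl_ambient p" "inf f g \<in> fbl_ambient p"
    using fbl_ambient_dominated[OF p f g] by blast+
qed

lemma fbl_ambient_cmult:
  assumes p: "1 \<le> p" and f: "f \<in> fbl_ambient p"
  shows "(\<lambda>\<phi>. c * f \<phi>) \<in> fbl_ambient p"
  unfolding fbl_ambient_iff[OF p]
proof
  show "positively_homogeneous (\<lambda>\<phi>. c * f \<phi>)"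
    using f by (simp add: fbl_ambient_def positively_homogeneous_def)
  show "\<exists>K. fbl_bound p K (\<lambda>\<phi>. c * f \<phi>)"
    using fbl_bound_cmult[OF fbl_bound_norm[OF p f]] by blast
qed

lemma zero_in_fbl_ambient: "1 \<le> p \<Longrightarrow> 0 \<in> fbl_ambient p"
  using fbl_ambient_cmult[OF _ evaluation_in_fbl_ambient, of p 0 0] by (simp add: zero_fun_def)

lemma closed_sublattice_fbl_ambient: "1 \<le> p \<Longrightarrow> closed_sublattice p (fbl_ambient p)"
  by (simp add: closed_sublattice_def zero_in_fbl_ambient fbl_ambient_lattice_closed fbl_ambient_cmult)

lemma closed_sublattice_Inter:
  assumes "\<T> \<noteq> {}" "\<And>S. S \<in> \<T> \<Longrightarrow> closed_sublattice p S"
  shows "closed_sublattice p (\<Inter>\<T>)"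
proof -
  have sub: "S \<subseteq> fbl_ambient p" and zero: "0 \<in> S"
    and lattice: "\<And>f g. f \<in> S \<Longrightarrow> g \<in> S \<Longrightarrow> f + g \<in> S \<and> sup f g \<in> S \<and> inf f g \<in> S"
    and cmult: "\<And>c f. f \<in> S \<Longrightarrow> (\<lambda>\<phi>. c * f \<phi>) \<in> S"
    and lim: "\<And>h f. (\<forall>n. h n \<in> S) \<Longrightarrow> f \<in> fbl_ambient p \<Longrightarrow>
      (\<lambda>n. fbl_norm p (h n - f)) \<longlonglongrightarrow> 0 \<Longrightarrow> f \<in> S"
    if "S \<in> \<T>" for S
    using assms(2)[OF that] unfolding closed_sublattice_def by metis+
  show ?thesis
    unfolding closed_sublattice_def
  proof (intro conjI allI ballI impI)
    show "\<Inter>\<T> \<subseteq> fbl_ambient p" using sub assms(1) by blast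
    show "0 \<in> \<Inter>\<T>" using zero by blast
    show "f + g \<in> \<Inter>\<T>" "sup f g \<in> \<Inter>\<T>" "inf f g \<in> \<Inter>\<T>" if "f \<in> \<Inter>\<T>" "g \<in> \<Inter>\<T>" for f g
      using lattice that by (meson InterE InterI)+
    show "(\<lambda>\<phi>. c * f \<phi>) \<in> \<Inter>\<T>" if "f \<in> \<Inter>\<T>" for c f
      using cmult that by (meson InterE InterI)
    show "f \<in> \<Inter>\<T>"
      if "(\<forall>n. h n \<in> \<Inter>\<T>) \<and> f \<in> fbl_ambient p \<and> (\<lambda>n. fbl_norm p (h n - f)) \<longlonglongrightarrow> 0" for h f
      using lim that by (meson InterE InterI)
  qed
qed

text \<open>The intersection that defines the hull is over a non-empty collection, since the ambient lattice takes part in it;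
  an empty intersection would not consist of functions of finite norm.\<close>

lemma closed_sublattice_FBL:
  assumes "1 \<le> p"
  shows "closed_sublattice p (FBL p)"
  unfolding FBL_def hull_def
proof (rule closed_sublattice_Inter)
  have "fbl_ambient p \<in> {t. closed_sublattice p t \<and> range evaluation \<subseteq> t}"
    using closed_sublattice_fbl_ambient[OF assms] evaluation_in_fbl_ambient[OF assms] by blast
  then show "{t. closed_sublattice p t \<and> range evaluation \<subseteq> t} \<noteq> {}" by blast
qed simp

section \<open>Closed sublattices and \<open>p\<close>-sums\<close>

definition p_norm2 :: "real \<Rightarrow> real \<Rightarrow> real \<Rightarrow> real" where
  "p_norm2 p s t = (s powr p + t powr p) powr (1 / p)"

lemma p_norm2_powr:
  assumes "1 \<le> p"
  shows "p_norm2 p s t powr p = s powr p + t powr p"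
  using assms by (simp add: p_norm2_def powr_powr)

lemma p_norm2_scale:
  assumes "1 \<le> p" "0 \<le> c" "0 \<le> s" "0 \<le> t"
  shows "p_norm2 p (c * s) (c * t) = c * p_norm2 p s t"
proof -
  have "(c * s) powr p + (c * t) powr p = c powr p * (s powr p + t powr p)"
    using assms by (simp add: powr_mult distrib_left)
  with assms show ?thesis by (simp add: p_norm2_def powr_mult powr_powr)
qed

lemma p_norm2_le_add:
  assumes "1 \<le> p" "0 \<le> s" "0 \<le> t"
  shows "p_norm2 p s t \<le> s + t"
  unfolding p_norm2_def using assms powr_add_superadditive[OF assms]
  by (subst powr_inverse_le_iff) auto

text \<open>Young's inequality with the exponent \<open>p - 1\<close> on one factor in place of the conjugate exponent \<open>p / (p - 1)\<close>, which
  keeps \<open>p = 1\<close> in scope.\<close>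

lemma powr_Young:
  fixes a b p :: real
  assumes "1 \<le> p" "0 \<le> a" "0 \<le> b"
  shows "a powr (p - 1) * b \<le> (1 - 1 / p) * a powr p + 1 / p * b powr p"
proof (cases "a = 0 \<or> b = 0")
  case True
  with assms show ?thesis by auto
next
  case False
  with assms have "(a powr p) powr (1 - 1 / p) * (b powr p) powr (1 / p)
      \<le> (1 - 1 / p) * a powr p + 1 / p * b powr p"
    by (intro Youngs_inequality_0) auto
  moreover have "p * (1 - 1 / p) = p - 1" using assms by (simp add: field_simps)
  ultimately show ?thesis using False assms by (simp add: powr_powr)
qed

text \<open>The supporting linear form at \<open>(s\<^sub>0, t\<^sub>0)\<close>: after normalising \<open>(s\<^sub>0, t\<^sub>0)\<close> to \<open>(a, b)\<close> of \<open>p\<close>-norm \<open>1\<close>, its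
  coefficients are \<open>a\<^sup>p\<^sup>-\<^sup>1\<close> and \<open>b\<^sup>p\<^sup>-\<^sup>1\<close>. It lies below the norm by Young's inequality.
  For \<open>p = 1\<close> and \<open>a = 0\<close> the convention \<open>0 powr 0 = 0\<close> makes the coefficient vanish, which still gives a supporting form.\<close>

lemma p_norm2_support:
  assumes p: "1 \<le> p" and "0 \<le> s0" "0 \<le> t0"
  shows "\<exists>\<alpha> \<beta>. (\<forall>s t. 0 \<le> s \<longrightarrow> 0 \<le> t \<longrightarrow> \<alpha> * s + \<beta> * t \<le> p_norm2 p s t) \<and>
    \<alpha> * s0 + \<beta> * t0 = p_norm2 p s0 t0"
proof (cases "s0 = 0 \<and> t0 = 0")
  case True
  then show ?thesis by (intro exI[of _ 0]) (simp add: p_norm2_def)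
next
  case False
  have pos: "0 < p_norm2 p s t" if "\<not> (s = 0 \<and> t = 0)" for s t
  proof -
    have "0 < s powr p + t powr p" using that by (auto intro: add_pos_nonneg add_nonneg_pos)
    then show ?thesis by (simp add: p_norm2_def)
  qed
  define n where "n = p_norm2 p s0 t0"
  have n: "0 < n" using pos[OF False] by (simp add: n_def)
  define a b where "a = s0 / n" and "b = t0 / n"
  have ab: "0 \<le> a" "0 \<le> b" using assms n by (auto simp: a_def b_def)
  have s0t0: "s0 = n * a" "t0 = n * b" using n by (auto simp: a_def b_def)
  have normalised: "(s / p_norm2 p s t) powr p + (t / p_norm2 p s t) powr p = 1"
    if "\<not> (s = 0 \<and> t = 0)" "0 \<le> s" "0 \<le> t" for s t
  proof -
    have "(s / p_norm2 p s t) powr p + (t / p_norm2 p s t) powr p =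
        (s powr p + t powr p) / p_norm2 p s t powr p"
      using that pos[OF that(1)] by (simp add: powr_divide add_divide_distrib)
    moreover have "p_norm2 p s t powr p \<noteq> 0" using pos[OF that(1)] by simp
    ultimately show ?thesis unfolding p_norm2_powr[OF p] by simp
  qed
  have sum1: "a powr p + b powr p = 1"
    using normalised[OF False assms(2,3)] by (simp add: a_def b_def n_def)
  show ?thesis
  proof (rule exI[of _ "a powr (p - 1)"], rule exI[of _ "b powr (p - 1)"], intro conjI allI impI)
    fix s t :: real assume st: "0 \<le> s" "0 \<le> t"
    show "a powr (p - 1) * s + b powr (p - 1) * t \<le> p_norm2 p s t"
    proof (cases "s = 0 \<and> t = 0")
      case True
      then show ?thesis by (simp add: p_norm2_def)
    next
      case nz: False
      define r where "r = p_norm2 p s t"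
      have r: "0 < r" using pos[OF nz] by (simp add: r_def)
      have "a powr (p - 1) * (s / r) + b powr (p - 1) * (t / r)
          \<le> ((1 - 1 / p) * a powr p + 1 / p * (s / r) powr p) +
            ((1 - 1 / p) * b powr p + 1 / p * (t / r) powr p)"
        using ab st r by (intro add_mono powr_Young[OF p]) auto
      also have "\<dots> = (1 - 1 / p) * (a powr p + b powr p) + 1 / p * ((s / r) powr p + (t / r) powr p)"
        by (simp only: distrib_left)
      also have "\<dots> = 1" using sum1 normalised[OF nz st] by (simp add: r_def)
      finally have "(a powr (p - 1) * s + b powr (p - 1) * t) / r \<le> 1"
        by (simp add: add_divide_distrib)
      with r show ?thesis by (simp add: r_def)
    qed
  next
    have "a powr (p - 1) * a = a powr p" "b powr (p - 1) * b = b powr p"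
      using ab powr_mult_base[of a "p - 1"] powr_mult_base[of b "p - 1"] by (simp_all add: mult.commute)
    then have "a powr (p - 1) * s0 + b powr (p - 1) * t0 = n * (a powr p + b powr p)"
      unfolding s0t0 by (simp only: distrib_left mult.left_commute[of _ n])
    with sum1 show "a powr (p - 1) * s0 + b powr (p - 1) * t0 = p_norm2 p s0 t0"
      by (simp add: n_def)
  qed
qed

text \<open>By homogeneity it suffices to approximate on the segment \<open>s + t = 1\<close>. Each supporting form is within \<open>e\<close> of the norm
  near its point of contact, and finitely many such neighbourhoods cover the segment.\<close>

lemma p_norm2_finite_approximation:
  assumes p: "1 \<le> p" and e: "0 < e"
  shows "\<exists>\<Theta>. finite \<Theta> \<and> \<Theta> \<noteq> {} \<and>
    (\<forall>(\<alpha>, \<beta>)\<in>\<Theta>. \<forall>s t. 0 \<le> s \<longrightarrow> 0 \<le> t \<longrightarrow> \<alpha> * s + \<beta> * t \<le> p_norm2 p s t) \<and>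
    (\<forall>s t. 0 \<le> s \<longrightarrow> 0 \<le> t \<longrightarrow> (\<exists>(\<alpha>, \<beta>)\<in>\<Theta>. p_norm2 p s t \<le> \<alpha> * s + \<beta> * t + e * (s + t)))"
proof -
  have "\<forall>u\<in>{0..1::real}. \<exists>\<alpha> \<beta>. (\<forall>s t. 0 \<le> s \<longrightarrow> 0 \<le> t \<longrightarrow> \<alpha> * s + \<beta> * t \<le> p_norm2 p s t) \<and>
    \<alpha> * u + \<beta> * (1 - u) = p_norm2 p u (1 - u)"
    using p_norm2_support[OF p] by auto
  then obtain \<alpha> \<beta> where below: "\<And>u s t. u \<in> {0..1} \<Longrightarrow> 0 \<le> s \<Longrightarrow> 0 \<le> t \<Longrightarrow> \<alpha> u * s + \<beta> u * t \<le> p_norm2 p s t"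
    and touch: "\<And>u. u \<in> {0..1} \<Longrightarrow> \<alpha> u * u + \<beta> u * (1 - u) = p_norm2 p u (1 - u)"
    by metis
  define V where "V u = {v. (\<bar>v\<bar> powr p + \<bar>1 - v\<bar> powr p) powr (1 / p) < \<alpha> u * v + \<beta> u * (1 - v) + e}" for u
  have "open (V u)" for u
    unfolding V_def using p
    by (intro open_Collect_less continuous_intros continuous_on_powr') auto
  moreover have V: "v \<in> V u \<longleftrightarrow> p_norm2 p v (1 - v) < \<alpha> u * v + \<beta> u * (1 - v) + e"
    if "v \<in> {0..1}" for u v
    using that by (simp add: V_def p_norm2_def)
  have "{0..1} \<subseteq> (\<Union>u\<in>{0..1}. V u)"
    using V touch e by fastforce
  ultimately obtain U where U: "U \<subseteq> {0..1}" "finite U" "{0..1} \<subseteq> (\<Union>u\<in>U. V u)"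
    using compactE_image[of "{0..1::real}" "{0..1}" V] by blast
  show ?thesis
  proof (intro exI[of _ "(\<lambda>u. (\<alpha> u, \<beta> u)) ` U"] conjI)
    show "finite ((\<lambda>u. (\<alpha> u, \<beta> u)) ` U)" using U by simp
    show "(\<lambda>u. (\<alpha> u, \<beta> u)) ` U \<noteq> {}" using U(3) by auto
    show "\<forall>(\<alpha>, \<beta>)\<in>(\<lambda>u. (\<alpha> u, \<beta> u)) ` U. \<forall>s t. 0 \<le> s \<longrightarrow> 0 \<le> t \<longrightarrow> \<alpha> * s + \<beta> * t \<le> p_norm2 p s t"
      using below U(1) by auto
    have "\<exists>u\<in>U. p_norm2 p s t \<le> \<alpha> u * s + \<beta> u * t + e * (s + t)" if st: "0 \<le> s" "0 \<le> t" for s t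
    proof (cases "s + t = 0")
      case True
      with st have "s = 0" "t = 0" by auto
      moreover obtain u where "u \<in> U" using U(3) by fastforce
      ultimately show ?thesis by (auto simp: p_norm2_def)
    next
      case False
      define c v where "c = s + t" and "v = s / (s + t)"
      have c: "0 < c" and v: "v \<in> {0..1}" using False st by (auto simp: c_def v_def)
      have s: "s = c * v" and t: "t = c * (1 - v)"
        using False by (auto simp: c_def v_def field_simps)
      obtain u where "u \<in> U" "v \<in> V u" using U(3) v by blast
      then have "c * p_norm2 p v (1 - v) \<le> c * (\<alpha> u * v + \<beta> u * (1 - v) + e)"
        using V[OF v] c by (intro mult_left_mono) auto
      moreover have "p_norm2 p s t = c * p_norm2 p v (1 - v)"
        unfolding s t using v c p by (intro p_norm2_scale) auto
      moreover have "c * (\<alpha> u * v + \<beta> u * (1 - v) + e) = \<alpha> u * s + \<beta> u * t + e * (s + t)"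
        unfolding c_def[symmetric] unfolding s t by (simp add: algebra_simps)
      ultimately show ?thesis using \<open>u \<in> U\<close> by auto
    qed
    then show "\<forall>s t. 0 \<le> s \<longrightarrow> 0 \<le> t \<longrightarrow>
        (\<exists>(\<alpha>, \<beta>)\<in>(\<lambda>u. (\<alpha> u, \<beta> u)) ` U. p_norm2 p s t \<le> \<alpha> * s + \<beta> * t + e * (s + t))"
      by simp
  qed
qed

lemma closed_sublatticeD:
  assumes "closed_sublattice p S"
  shows "S \<subseteq> fbl_ambient p" "0 \<in> S"
    "f \<in> S \<Longrightarrow> g \<in> S \<Longrightarrow> f + g \<in> S" "f \<in> S \<Longrightarrow> g \<in> S \<Longrightarrow> sup f g \<in> S"
    "f \<in> S \<Longrightarrow> (\<lambda>\<phi>. c * f \<phi>) \<in> S"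
    "(\<And>n. h n \<in> S) \<Longrightarrow> f \<in> fbl_ambient p \<Longrightarrow> (\<lambda>n. fbl_norm p (h n - f)) \<longlonglongrightarrow> 0 \<Longrightarrow> f \<in> S"
  using assms unfolding closed_sublattice_def by blast+

lemma closed_sublattice_Max:
  assumes S: "closed_sublattice p S" and "finite I" "I \<noteq> {}" and "\<And>i. i \<in> I \<Longrightarrow> f i \<in> S"
  shows "(\<lambda>\<phi>. Max ((\<lambda>i. f i \<phi>) ` I)) \<in> S"
  using assms(2-4)
proof (induction I rule: finite_ne_induct)
  case (singleton i)
  then show ?case by simp
next
  case (insert i I)
  then have "sup (f i) (\<lambda>\<phi>. Max ((\<lambda>i. f i \<phi>) ` I)) \<in> S"
    by (intro closed_sublatticeD(4)[OF S]) auto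
  with insert show ?case by (simp add: sup_fun_def sup_real_def)
qed

lemma closed_sublattice_approximation:
  assumes p: "1 \<le> p" and S: "closed_sublattice p S" and f: "f \<in> fbl_ambient p"
    and approx: "\<And>e. 0 < e \<Longrightarrow> \<exists>h\<in>S. fbl_norm p (h - f) \<le> e"
  shows "f \<in> S"
proof -
  have "\<forall>n. \<exists>h\<in>S. fbl_norm p (h - f) \<le> inverse (real (Suc n))" using approx by simp
  then obtain h where h: "\<And>n. h n \<in> S" "\<And>n. fbl_norm p (h n - f) \<le> inverse (real (Suc n))"
    by metis
  have "0 \<le> fbl_norm p (h n - f)" for n
    using h(1) closed_sublatticeD(1)[OF S] f
    by (intro fbl_norm_nonneg[OF p] fbl_ambient_lattice_closed[OF p]) auto
  then have "(\<lambda>n. fbl_norm p (h n - f)) \<longlonglongrightarrow> 0"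
    by (intro tendsto_sandwich[OF _ _ tendsto_const LIMSEQ_inverse_real_of_nat] always_eventually allI h(2))
  then show ?thesis by (rule closed_sublatticeD(6)[OF S h(1) f])
qed

text \<open>The \<open>p\<close>-sum is a norm limit of maxima of finitely many linear combinations of \<open>f\<close> and \<open>g\<close>: a
  pointwise error of at most \<open>d (f + g)\<close> is an error of at most \<open>d \<parallel>f + g\<parallel>\<close> in the lattice norm.\<close>

lemma closed_sublattice_p_norm2:
  assumes p: "1 \<le> p" and S: "closed_sublattice p S" and f: "f \<in> S" "0 \<le> f" and g: "g \<in> S" "0 \<le> g"
  shows "(\<lambda>\<phi>. p_norm2 p (f \<phi>) (g \<phi>)) \<in> S"
proof (rule closed_sublattice_approximation[OF p S])
  have fg: "f \<in> fbl_ambient p" "g \<in> fbl_ambient p" using closed_sublatticeD(1)[OF S] f g by auto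
  have pos: "0 \<le> f \<phi>" "0 \<le> g \<phi>" for \<phi> using f(2) g(2) by (auto simp: le_fun_def)
  show amb: "(\<lambda>\<phi>. p_norm2 p (f \<phi>) (g \<phi>)) \<in> fbl_ambient p"
  proof (rule fbl_ambient_dominated[OF p fg])
    show "positively_homogeneous (\<lambda>\<phi>. p_norm2 p (f \<phi>) (g \<phi>))"
      using fg p pos by (simp add: fbl_ambient_def positively_homogeneous_def p_norm2_scale)
    show "\<bar>p_norm2 p (f \<phi>) (g \<phi>)\<bar> \<le> \<bar>f \<phi>\<bar> + \<bar>g \<phi>\<bar>" for \<phi>
      using p_norm2_le_add[OF p pos(1) pos(2), of \<phi> \<phi>] pos[of \<phi>] by (simp add: p_norm2_def)
  qed
  fix e :: real assume e: "0 < e"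
  define K where "K = fbl_norm p (f + g)"
  have K: "fbl_bound p K (f + g)" "0 \<le> K"
    unfolding K_def by (intro fbl_bound_norm fbl_norm_nonneg fbl_ambient_lattice_closed p fg)+
  define d where "d = e / (K + 1)"
  have d: "0 < d" "d * K \<le> e" using e K(2) by (auto simp: d_def field_simps)
  obtain \<Theta> where \<Theta>: "finite \<Theta>" "\<Theta> \<noteq> {}"
    and below: "\<forall>(\<alpha>, \<beta>)\<in>\<Theta>. \<forall>s t. 0 \<le> s \<longrightarrow> 0 \<le> t \<longrightarrow> \<alpha> * s + \<beta> * t \<le> p_norm2 p s t"
    and above: "\<forall>s t. 0 \<le> s \<longrightarrow> 0 \<le> t \<longrightarrow>
      (\<exists>(\<alpha>, \<beta>)\<in>\<Theta>. p_norm2 p s t \<le> \<alpha> * s + \<beta> * t + d * (s + t))"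
    using p_norm2_finite_approximation[OF p d(1)] by (elim exE conjE)
  define l where "l \<theta> = (\<lambda>\<phi>. fst \<theta> * f \<phi> + snd \<theta> * g \<phi>)" for \<theta> :: "real \<times> real"
  define h where "h = (\<lambda>\<phi>. Max ((\<lambda>\<theta>. l \<theta> \<phi>) ` \<Theta>))"
  have "l \<theta> \<in> S" for \<theta>
    using closed_sublatticeD(3)[OF S closed_sublatticeD(5)[OF S f(1)] closed_sublatticeD(5)[OF S g(1)]]
    by (simp add: l_def plus_fun_def)
  then have "h \<in> S" unfolding h_def by (rule closed_sublattice_Max[OF S \<Theta>])
  moreover have "fbl_norm p (h - (\<lambda>\<phi>. p_norm2 p (f \<phi>) (g \<phi>))) \<le> e"
  proof -
    have "\<bar>h \<phi> - p_norm2 p (f \<phi>) (g \<phi>)\<bar> \<le> d * (f \<phi> + g \<phi>)" for \<phi>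
    proof -
      have "h \<phi> \<le> p_norm2 p (f \<phi>) (g \<phi>)"
        unfolding h_def using \<Theta> below pos[of \<phi>] by (subst Max_le_iff) (fastforce simp: l_def)+
      moreover obtain \<alpha> \<beta> where \<theta>: "(\<alpha>, \<beta>) \<in> \<Theta>"
        "p_norm2 p (f \<phi>) (g \<phi>) \<le> \<alpha> * f \<phi> + \<beta> * g \<phi> + d * (f \<phi> + g \<phi>)"
        using above pos by blast
      moreover have "l (\<alpha>, \<beta>) \<phi> \<le> h \<phi>"
        unfolding h_def using \<theta>(1) \<Theta> by (intro Max_ge) auto
      ultimately show ?thesis by (simp add: l_def abs_le_iff)
    qed
    moreover have "0 \<le> d * (f \<phi> + g \<phi>)" for \<phi> using d pos by simp
    ultimately have "fbl_bound p (\<bar>d\<bar> * K) (h - (\<lambda>\<phi>. p_norm2 p (f \<phi>) (g \<phi>)))"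
      using p by (intro fbl_bound_mono[OF _ fbl_bound_cmult[OF K(1)]]) auto
    from fbl_norm_le[OF p this] d show ?thesis by simp
  qed
  ultimately show "\<exists>h\<in>S. fbl_norm p (h - (\<lambda>\<phi>. p_norm2 p (f \<phi>) (g \<phi>))) \<le> e" by blast
qed

section \<open>Functionals on \<open>\<ell>\<^sub>1(A)\<close> and their truncations\<close>

text \<open>Summing Young's inequality for \<open>m\<^sup>p\<^sup>-\<^sup>1 c\<^sub>i\<close>, where \<open>m\<close> is the weighted sum of the \<open>c\<^sub>i\<close>,
  gives the claim after the multiple \<open>1 - 1 / p\<close> of \<open>m\<^sup>p\<close> is cancelled.\<close>

lemma powr_sum_Jensen:
  fixes w c :: "'i \<Rightarrow> real"
  assumes p: "1 \<le> p" and w: "\<And>i. i \<in> I \<Longrightarrow> 0 \<le> w i" "sum w I \<le> 1" and c: "\<And>i. i \<in> I \<Longrightarrow> 0 \<le> c i"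
  shows "(\<Sum>i\<in>I. w i * c i) powr p \<le> (\<Sum>i\<in>I. w i * c i powr p)"
proof -
  define m where "m = (\<Sum>i\<in>I. w i * c i)"
  have m: "0 \<le> m" unfolding m_def using w c by (intro sum_nonneg) simp
  have "m powr p = m powr (p - 1) * m" using powr_mult_base[OF m, of "p - 1"] by (simp add: mult.commute)
  also have "\<dots> = (\<Sum>i\<in>I. w i * (m powr (p - 1) * c i))"
    by (simp add: m_def sum_distrib_left mult.left_commute)
  also have "\<dots> \<le> (\<Sum>i\<in>I. w i * ((1 - 1 / p) * m powr p + 1 / p * c i powr p))"
    using w c m by (intro sum_mono mult_left_mono powr_Young[OF p])
  also have "\<dots> = (1 - 1 / p) * m powr p * sum w I + 1 / p * (\<Sum>i\<in>I. w i * c i powr p)"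
    by (simp add: distrib_left sum.distrib sum_distrib_left sum_distrib_right mult_ac)
  also have "\<dots> \<le> (1 - 1 / p) * m powr p + 1 / p * (\<Sum>i\<in>I. w i * c i powr p)"
    using w p by (intro add_right_mono mult_left_le) auto
  finally have "1 / p * m powr p \<le> 1 / p * (\<Sum>i\<in>I. w i * c i powr p)"
    by (simp add: left_diff_distrib)
  with p show ?thesis unfolding m_def by (simp add: divide_le_cancel)
qed

definition unit_ell1 :: "'a \<Rightarrow> 'a ell1" where
  "unit_ell1 a = Abs_ell1 (\<lambda>i. if i = a then 1 else 0)"

lemma ell1_coord_unit: "ell1_coord (unit_ell1 a) i = (if i = a then 1 else 0)"
proof -
  have "(\<lambda>i. \<bar>if i = a then 1 else 0 :: real\<bar>) summable_on UNIV"
    by (rule finite_nonzero_values_imp_summable_on) (rule finite_subset[of _ "{a}"], auto)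
  then show ?thesis by (simp add: unit_ell1_def Abs_ell1_inverse)
qed

lemma ell1_coord_sum: "ell1_coord (\<Sum>a\<in>F. x a) i = (\<Sum>a\<in>F. ell1_coord (x a) i)"
  by (induction F rule: infinite_finite_induct) (simp_all add: zero_ell1.rep_eq plus_ell1.rep_eq)

lemma norm_ell1_le:
  assumes "\<And>F. finite F \<Longrightarrow> (\<Sum>i\<in>F. \<bar>ell1_coord x i\<bar>) \<le> b"
  shows "norm x \<le> b"
  unfolding norm_ell1.rep_eq using assms by (intro infsum_le_finite_sums summable_ell1)

lemma norm_unit_ell1_le: "norm (unit_ell1 a) \<le> 1"
  by (rule norm_ell1_le) (simp add: ell1_coord_unit if_distrib[of abs] sum.delta cong: if_cong)

text \<open>The error of the partial sum over \<open>F\<close> has norm \<open>\<parallel>x\<parallel> - (\<Sum>a\<in>F. |x\<^sub>a|)\<close>.\<close>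

lemma unit_expansion_tendsto:
  "((\<lambda>F. \<Sum>a\<in>F. ell1_coord x a *\<^sub>R unit_ell1 a) \<longlongrightarrow> x) (finite_subsets_at_top UNIV)"
proof -
  let ?P = "\<lambda>F. \<Sum>a\<in>F. ell1_coord x a *\<^sub>R unit_ell1 a"
  have tail: "norm (?P F - x) \<le> norm x - (\<Sum>a\<in>F. \<bar>ell1_coord x a\<bar>)" if F: "finite F" for F
  proof (rule norm_ell1_le)
    fix G :: "'a set" assume G: "finite G"
    have coord: "ell1_coord (?P F - x) i = (if i \<in> F then 0 else - ell1_coord x i)" for i
    proof -
      have "ell1_coord (?P F) i = (\<Sum>a\<in>F. if i = a then ell1_coord x a else 0)"
        unfolding ell1_coord_sum by (intro sum.cong) (auto simp: scaleR_ell1.rep_eq ell1_coord_unit)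
      with F show ?thesis by (simp add: minus_ell1.rep_eq)
    qed
    have "(\<Sum>i\<in>G. \<bar>ell1_coord (?P F - x) i\<bar>) = (\<Sum>i\<in>G. if i \<in> - F then \<bar>ell1_coord x i\<bar> else 0)"
      by (intro sum.cong) (auto simp: coord)
    also have "\<dots> = (\<Sum>i\<in>G \<inter> - F. \<bar>ell1_coord x i\<bar>)" using G by (simp add: sum.inter_restrict)
    also have "\<dots> = (\<Sum>i\<in>(G \<inter> - F) \<union> F. \<bar>ell1_coord x i\<bar>) - (\<Sum>i\<in>F. \<bar>ell1_coord x i\<bar>)"
      using F G by (subst sum.union_disjoint) auto
    also have "\<dots> \<le> norm x - (\<Sum>i\<in>F. \<bar>ell1_coord x i\<bar>)"
      using F G by (intro diff_right_mono sum_abs_le_norm_ell1) auto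
    finally show "(\<Sum>i\<in>G. \<bar>ell1_coord (?P F - x) i\<bar>) \<le> norm x - (\<Sum>i\<in>F. \<bar>ell1_coord x i\<bar>)" .
  qed
  have "((\<lambda>F. norm x - (\<Sum>a\<in>F. \<bar>ell1_coord x a\<bar>)) \<longlongrightarrow> norm x - norm x) (finite_subsets_at_top UNIV)"
    using infsum_tendsto[OF summable_ell1[of x]]
    by (intro tendsto_diff tendsto_const) (simp add: norm_ell1.rep_eq)
  then have "((\<lambda>F. norm x - (\<Sum>a\<in>F. \<bar>ell1_coord x a\<bar>)) \<longlongrightarrow> 0) (finite_subsets_at_top UNIV)" by simp
  moreover have "\<forall>\<^sub>F F in finite_subsets_at_top UNIV. norm (?P F - x) \<le> norm x - (\<Sum>a\<in>F. \<bar>ell1_coord x a\<bar>)"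
    using tail by (rule eventually_finite_subsets_at_top_weakI)
  ultimately have "((\<lambda>F. ?P F - x) \<longlongrightarrow> 0) (finite_subsets_at_top UNIV)"
    by (rule Lim_null_comparison[rotated])
  then show ?thesis by (simp add: LIM_zero_iff)
qed

lemma blinfun_unit_expansion_tendsto:
  fixes \<phi> :: "'a ell1 \<Rightarrow>\<^sub>L real"
  shows "((\<lambda>F. \<Sum>a\<in>F. ell1_coord x a * blinfun_apply \<phi> (unit_ell1 a)) \<longlongrightarrow> blinfun_apply \<phi> x)
    (finite_subsets_at_top UNIV)"
  using blinfun.tendsto[OF tendsto_const[of \<phi>] unit_expansion_tendsto[of x]]
  by (simp add: blinfun.sum_right blinfun.scaleR_right)

lemma abs_blinfun_unit_le: "\<bar>blinfun_apply \<phi> (unit_ell1 a)\<bar> \<le> norm \<phi>"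
  using norm_blinfun[of \<phi> "unit_ell1 a"] mult_left_le[OF norm_unit_ell1_le norm_ge_zero[of \<phi>], of a]
  by simp

text \<open>This is where \<open>\<ell>\<^sub>1\<close> is special: its unit ball is the closed absolutely convex hull of the unit vectors, and
  \<open>x \<mapsto> \<Sum>\<^sub>i |\<phi>\<^sub>i x|\<^sup>p\<close> is convex and even, so its supremum is that over the unit vectors.\<close>

lemma weak_p_bound_ell1:
  fixes \<phi> :: "'i \<Rightarrow> 'a ell1 \<Rightarrow>\<^sub>L real"
  assumes p: "1 \<le> p" and W: "\<And>a. (\<Sum>i\<in>I. \<bar>blinfun_apply (\<phi> i) (unit_ell1 a)\<bar> powr p) \<le> W"
  shows "weak_p_bound p W I \<phi>"
  unfolding weak_p_bound_def
proof (intro allI impI)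
  fix x :: "'a ell1" assume x: "norm x \<le> 1"
  let ?c = "\<lambda>i a. blinfun_apply (\<phi> i) (unit_ell1 a)"
  have W0: "0 \<le> W"
    using W[of undefined] by (rule order_trans[rotated]) (simp add: sum_nonneg)
  have "(\<Sum>i\<in>I. \<bar>\<Sum>a\<in>F. ell1_coord x a * ?c i a\<bar> powr p) \<le> W" if F: "finite F" for F
  proof -
    have x1: "(\<Sum>a\<in>F. \<bar>ell1_coord x a\<bar>) \<le> 1" using sum_abs_le_norm_ell1[OF F, of x] x by simp
    have "\<bar>\<Sum>a\<in>F. ell1_coord x a * ?c i a\<bar> powr p \<le> (\<Sum>a\<in>F. \<bar>ell1_coord x a\<bar> * \<bar>?c i a\<bar>) powr p" for i
      using p by (intro powr_mono2) (auto simp flip: abs_mult)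
    also have "\<dots> i \<le> (\<Sum>a\<in>F. \<bar>ell1_coord x a\<bar> * \<bar>?c i a\<bar> powr p)" for i
      using x1 by (intro powr_sum_Jensen[OF p]) auto
    finally have "(\<Sum>i\<in>I. \<bar>\<Sum>a\<in>F. ell1_coord x a * ?c i a\<bar> powr p)
        \<le> (\<Sum>i\<in>I. \<Sum>a\<in>F. \<bar>ell1_coord x a\<bar> * \<bar>?c i a\<bar> powr p)"
      by (intro sum_mono)
    also have "\<dots> = (\<Sum>a\<in>F. \<bar>ell1_coord x a\<bar> * (\<Sum>i\<in>I. \<bar>?c i a\<bar> powr p))"
      by (subst sum.swap) (simp add: sum_distrib_left)
    also have "\<dots> \<le> (\<Sum>a\<in>F. \<bar>ell1_coord x a\<bar> * W)"
      using W by (intro sum_mono mult_left_mono) auto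
    also have "\<dots> \<le> W" using x1 W0 by (simp add: mult_left_le_one_le sum_nonneg flip: sum_distrib_right)
    finally show ?thesis .
  qed
  then have "\<forall>\<^sub>F F in finite_subsets_at_top UNIV. (\<Sum>i\<in>I. \<bar>\<Sum>a\<in>F. ell1_coord x a * ?c i a\<bar> powr p) \<le> W"
    by (rule eventually_finite_subsets_at_top_weakI)
  moreover have "((\<lambda>F. \<Sum>i\<in>I. \<bar>\<Sum>a\<in>F. ell1_coord x a * ?c i a\<bar> powr p) \<longlongrightarrow>
      (\<Sum>i\<in>I. \<bar>blinfun_apply (\<phi> i) x\<bar> powr p)) (finite_subsets_at_top UNIV)"
  proof (rule tendsto_sum)
    fix i
    show "((\<lambda>F. \<bar>\<Sum>a\<in>F. ell1_coord x a * ?c i a\<bar> powr p) \<longlongrightarrow> \<bar>blinfun_apply (\<phi> i) x\<bar> powr p)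
        (finite_subsets_at_top UNIV)"
      using p by (intro tendsto_powr'[OF tendsto_rabs[OF blinfun_unit_expansion_tendsto] tendsto_const]) auto
  qed
  ultimately show "(\<Sum>i\<in>I. \<bar>blinfun_apply (\<phi> i) x\<bar> powr p) \<le> W"
    by (intro tendsto_upperbound[of _ _ "finite_subsets_at_top UNIV"]) simp_all
qed

text \<open>For finite \<open>F\<close>, in terms of the dual space \<open>\<ell>\<^sub>\<infinity>(A)\<close>, this is multiplication by the
  indicator function of \<open>F\<close>.\<close>

definition restrict_functional :: "'a set \<Rightarrow> ('a ell1 \<Rightarrow>\<^sub>L real) \<Rightarrow> 'a ell1 \<Rightarrow>\<^sub>L real" where
  "restrict_functional F \<phi> = Blinfun (\<lambda>x. \<Sum>a\<in>F. ell1_coord x a * blinfun_apply \<phi> (unit_ell1 a))"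

lemma restrict_functional_bound:
  "\<bar>\<Sum>a\<in>F. ell1_coord x a * blinfun_apply \<phi> (unit_ell1 a)\<bar> \<le> norm \<phi> * norm x"
proof (cases "finite F")
  case True
  have "\<bar>\<Sum>a\<in>F. ell1_coord x a * blinfun_apply \<phi> (unit_ell1 a)\<bar> \<le> (\<Sum>a\<in>F. \<bar>ell1_coord x a\<bar> * norm \<phi>)"
    by (intro order_trans[OF sum_abs] sum_mono) (simp add: abs_mult mult_left_mono abs_blinfun_unit_le)
  also have "\<dots> \<le> norm x * norm \<phi>"
    unfolding sum_distrib_right[symmetric] by (intro mult_right_mono sum_abs_le_norm_ell1 True) simp
  finally show ?thesis by (simp add: mult.commute)
qed simp

lemma restrict_functional_apply:
  "blinfun_apply (restrict_functional F \<phi>) x = (\<Sum>a\<in>F. ell1_coord x a * blinfun_apply \<phi> (unit_ell1 a))"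
proof -
  have "bounded_linear (\<lambda>x. \<Sum>a\<in>F. ell1_coord x a * blinfun_apply \<phi> (unit_ell1 a))"
  proof (rule bounded_linear_intro)
    fix x y :: "'a ell1" and r :: real
    let ?g = "\<lambda>x. \<Sum>a\<in>F. ell1_coord x a * blinfun_apply \<phi> (unit_ell1 a)"
    show "?g (x + y) = ?g x + ?g y" by (simp add: plus_ell1.rep_eq distrib_right sum.distrib)
    show "?g (r *\<^sub>R x) = r *\<^sub>R ?g x" by (simp add: scaleR_ell1.rep_eq sum_distrib_left mult.assoc)
    show "norm (?g x) \<le> norm x * norm \<phi>"
      using restrict_functional_bound[of x \<phi> F] by (simp add: mult.commute)
  qed
  then show ?thesis by (simp add: restrict_functional_def bounded_linear_Blinfun_apply)
qed

lemma norm_restrict_functional_le: "norm (restrict_functional F \<phi>) \<le> norm \<phi>"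
  by (rule norm_blinfun_bound) (simp_all add: restrict_functional_apply restrict_functional_bound)

lemma restrict_functional_unit:
  assumes "finite F"
  shows "blinfun_apply (restrict_functional F \<phi>) (unit_ell1 a) =
    (if a \<in> F then blinfun_apply \<phi> (unit_ell1 a) else 0)"
  using assms by (simp add: restrict_functional_apply ell1_coord_unit if_distrib[of "\<lambda>x. x * _"] cong: if_cong)

lemma FBL_subset_ambient: "1 \<le> p \<Longrightarrow> FBL p \<subseteq> fbl_ambient p"
  using closed_sublattice_FBL closed_sublatticeD(1) by blast

lemma evaluation_in_FBL: "evaluation x \<in> FBL p"
  unfolding FBL_def by (rule hull_inc) simp

text \<open>The functions with this property form a closed sublattice: they pass to norm limits
  because truncation does not increase the norm of a functional and norm limits are uniform on bounded
  sets. Evaluations have it because the finite partial sums of the expansion of a vector converge.\<close>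

lemma FBL_restrict_tendsto:
  fixes f :: "'a ell1 \<Rightarrow>\<^sub>L real \<Rightarrow> real"
  assumes p: "1 \<le> p" and f: "f \<in> FBL p"
  shows "((\<lambda>F. f (restrict_functional F \<phi>)) \<longlongrightarrow> f \<phi>) (finite_subsets_at_top UNIV)"
proof -
  define T where "T = {f \<in> fbl_ambient p. \<forall>\<phi> :: 'a ell1 \<Rightarrow>\<^sub>L real.
    ((\<lambda>F. f (restrict_functional F \<phi>)) \<longlongrightarrow> f \<phi>) (finite_subsets_at_top UNIV)}"
  have "closed_sublattice p T"
    unfolding closed_sublattice_def
  proof (intro conjI ballI allI impI)
    show "T \<subseteq> fbl_ambient p" by (auto simp: T_def)
    show "0 \<in> T" using zero_in_fbl_ambient[OF p] by (simp add: T_def)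
    show "f + g \<in> T" "sup f g \<in> T" "inf f g \<in> T" if "f \<in> T" "g \<in> T" for f g
      using that fbl_ambient_lattice_closed[OF p, of f g]
      by (auto simp: T_def sup_real_def inf_real_def intro!: tendsto_add tendsto_max tendsto_min)
    show "(\<lambda>\<phi>. c * f \<phi>) \<in> T" if "f \<in> T" for c f
      using that fbl_ambient_cmult[OF p, of f c] by (auto simp: T_def intro!: tendsto_mult_left)
    fix h f
    assume *: "(\<forall>n. h n \<in> T) \<and> f \<in> fbl_ambient p \<and> (\<lambda>n. fbl_norm p (h n - f)) \<longlonglongrightarrow> 0"
    have "((\<lambda>F. f (restrict_functional F \<phi>)) \<longlongrightarrow> f \<phi>) (finite_subsets_at_top UNIV)" for \<phi>
    proof (rule tendstoI)
      fix e :: real assume e: "0 < e"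
      define d where "d = e / (3 * (norm \<phi> + 1))"
      have d: "0 < d" "d * norm \<phi> < e / 3"
      proof -
        have "0 < norm \<phi> + 1" by (simp add: add_nonneg_pos)
        with e show "0 < d" by (simp add: d_def)
        with \<open>0 < norm \<phi> + 1\<close> have "d * norm \<phi> < d * (norm \<phi> + 1)" by simp
        also have "\<dots> = e / 3" using \<open>0 < norm \<phi> + 1\<close> by (simp add: d_def field_simps)
        finally show "d * norm \<phi> < e / 3" .
      qed
      have "\<forall>\<^sub>F n in sequentially. fbl_norm p (h n - f) < d"
        using * d(1) by (intro order_tendstoD(2)) auto
      then obtain n where n: "fbl_norm p (h n - f) < d"
        by (auto simp: eventually_sequentially)
      have hn: "h n \<in> fbl_ambient p"
        and lim: "((\<lambda>F. h n (restrict_functional F \<phi>)) \<longlongrightarrow> h n \<phi>) (finite_subsets_at_top UNIV)"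
        using * by (auto simp: T_def)
      have amb: "h n - f \<in> fbl_ambient p"
        using hn * by (intro fbl_ambient_lattice_closed[OF p]) auto
      have close: "\<bar>h n \<psi> - f \<psi>\<bar> < e / 3" if "norm \<psi> \<le> norm \<phi>" for \<psi>
      proof -
        have "\<bar>(h n - f) \<psi>\<bar> \<le> fbl_norm p (h n - f) * norm \<psi>"
          using amb by (intro fbl_bound_pointwise[OF p _ fbl_bound_norm[OF p amb]]) (simp add: fbl_ambient_def)
        also have "\<dots> \<le> d * norm \<phi>" using n that d(1) by (intro mult_mono) auto
        finally show ?thesis using d(2) by simp
      qed
      have "\<forall>\<^sub>F F in finite_subsets_at_top UNIV. dist (h n (restrict_functional F \<phi>)) (h n \<phi>) < e / 3"
        using lim e by (intro tendstoD) auto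
      then show "\<forall>\<^sub>F F in finite_subsets_at_top UNIV. dist (f (restrict_functional F \<phi>)) (f \<phi>) < e"
      proof eventually_elim
        case (elim F)
        with close[of \<phi>] close[OF norm_restrict_functional_le, of F] show ?case
          unfolding dist_real_def abs_less_iff by linarith
      qed
    qed
    with * show "f \<in> T" by (simp add: T_def)
  qed
  moreover have "range evaluation \<subseteq> T"
    using evaluation_in_fbl_ambient[OF p] blinfun_unit_expansion_tendsto
    by (auto simp: T_def evaluation_def restrict_functional_apply)
  ultimately have "FBL p \<subseteq> T" unfolding FBL_def by (intro hull_minimal)
  with f show ?thesis by (auto simp: T_def)
qed

section \<open>Weighted \<open>p\<close>-norms and Pietsch domination\<close>

text \<open>The index set \<open>B\<close> varies so that finite partial sums, tails and the full series are
  instances of the same function.\<close>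

definition weighted_p_norm :: "real \<Rightarrow> ('a \<Rightarrow> real) \<Rightarrow> 'a set \<Rightarrow> ('a ell1 \<Rightarrow>\<^sub>L real) \<Rightarrow> real" where
  "weighted_p_norm p \<mu> B \<phi> =
    (\<Sum>\<^sub>\<infinity>a\<in>B. \<mu> a * \<bar>blinfun_apply \<phi> (unit_ell1 a)\<bar> powr p) powr (1 / p)"

context
  fixes p :: real and \<mu> :: "'a \<Rightarrow> real"
  assumes p: "1 \<le> p" and \<mu>: "\<mu> \<in> subprobability_weights"
begin

lemma weight_nonneg: "0 \<le> \<mu> a"
  using \<mu> by (simp add: subprobability_weights_def)

lemma weight_summable: "\<mu> summable_on B"
proof (rule nonneg_bdd_above_summable_on)
  show "bdd_above (sum \<mu> ` {F. F \<subseteq> B \<and> finite F})"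
    using \<mu> by (intro bdd_aboveI2[of _ _ 1]) (auto simp: subprobability_weights_def)
qed (rule weight_nonneg)

lemma infsum_weight_le_1: "infsum \<mu> B \<le> 1"
  using \<mu> by (intro infsum_le_finite_sums weight_summable) (auto simp: subprobability_weights_def)

lemma weighted_powers_summable:
  "(\<lambda>a. \<mu> a * \<bar>blinfun_apply \<phi> (unit_ell1 a)\<bar> powr p) summable_on B"
proof (rule summable_on_comparison_test)
  show "(\<lambda>a. \<mu> a * norm \<phi> powr p) summable_on B"
    by (intro summable_on_cmult_left weight_summable)
  show "\<mu> a * \<bar>blinfun_apply \<phi> (unit_ell1 a)\<bar> powr p \<le> \<mu> a * norm \<phi> powr p" for a
    using p by (intro mult_left_mono powr_mono2 abs_blinfun_unit_le weight_nonneg) auto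
qed (simp add: weight_nonneg)

lemma infsum_weighted_powers_nonneg:
  "0 \<le> (\<Sum>\<^sub>\<infinity>a\<in>B. \<mu> a * \<bar>blinfun_apply \<phi> (unit_ell1 a)\<bar> powr p)"
  by (intro infsum_nonneg) (simp add: weight_nonneg)

lemma weighted_p_norm_powr:
  "weighted_p_norm p \<mu> B \<phi> powr p = (\<Sum>\<^sub>\<infinity>a\<in>B. \<mu> a * \<bar>blinfun_apply \<phi> (unit_ell1 a)\<bar> powr p)"
  using p infsum_weighted_powers_nonneg by (simp add: weighted_p_norm_def powr_powr)

lemma weighted_p_norm_nonneg: "0 \<le> weighted_p_norm p \<mu> B \<phi>"
  by (simp add: weighted_p_norm_def)

lemma weighted_p_norm_homogeneous: "positively_homogeneous (weighted_p_norm p \<mu> B)"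
  unfolding positively_homogeneous_def
proof (intro allI impI)
  fix c :: real and \<phi> :: "'a ell1 \<Rightarrow>\<^sub>L real" assume c: "0 \<le> c"
  have "(\<Sum>\<^sub>\<infinity>a\<in>B. \<mu> a * \<bar>blinfun_apply (c *\<^sub>R \<phi>) (unit_ell1 a)\<bar> powr p) =
      (\<Sum>\<^sub>\<infinity>a\<in>B. c powr p * (\<mu> a * \<bar>blinfun_apply \<phi> (unit_ell1 a)\<bar> powr p))"
    using c by (intro infsum_cong) (simp add: scaleR_blinfun.rep_eq abs_mult powr_mult mult_ac)
  then show "weighted_p_norm p \<mu> B (c *\<^sub>R \<phi>) = c * weighted_p_norm p \<mu> B \<phi>"
    using c p infsum_weighted_powers_nonneg
    by (simp add: weighted_p_norm_def infsum_cmult_right' powr_mult powr_powr)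
qed

text \<open>Exchange the two sums. The inner one, at a unit vector, is at most \<open>1\<close>.\<close>

lemma weighted_p_norm_bound: "fbl_bound p (infsum \<mu> B powr (1 / p)) (weighted_p_norm p \<mu> B)"
  unfolding fbl_bound_def
proof (intro conjI allI impI)
  fix m :: nat and \<phi> :: "nat \<Rightarrow> 'a ell1 \<Rightarrow>\<^sub>L real"
  assume w: "weak_p_bound p 1 {..<m} \<phi>"
  let ?g = "\<lambda>i a. \<mu> a * \<bar>blinfun_apply (\<phi> i) (unit_ell1 a)\<bar> powr p"
  have "(\<Sum>i<m. \<Sum>a\<in>F. ?g i a) \<le> infsum \<mu> B" if F: "finite F" "F \<subseteq> B" for F
  proof -
    have "(\<Sum>i<m. \<Sum>a\<in>F. ?g i a) = (\<Sum>a\<in>F. \<mu> a * (\<Sum>i<m. \<bar>blinfun_apply (\<phi> i) (unit_ell1 a)\<bar> powr p))"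
      by (subst sum.swap) (simp add: sum_distrib_left)
    also have "\<dots> \<le> (\<Sum>a\<in>F. \<mu> a)"
      using w weight_nonneg
      by (intro sum_mono mult_left_le) (simp_all add: weak_p_bound_def norm_unit_ell1_le)
    also have "\<dots> \<le> infsum \<mu> B" by (intro finite_sum_le_infsum weight_summable weight_nonneg F)
    finally show ?thesis .
  qed
  then have "\<forall>\<^sub>F F in finite_subsets_at_top B. (\<Sum>i<m. \<Sum>a\<in>F. ?g i a) \<le> infsum \<mu> B"
    by (rule eventually_finite_subsets_at_top_weakI)
  moreover have "((\<lambda>F. \<Sum>i<m. \<Sum>a\<in>F. ?g i a) \<longlongrightarrow> (\<Sum>i<m. infsum (?g i) B)) (finite_subsets_at_top B)"
    by (intro tendsto_sum infsum_tendsto weighted_powers_summable)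
  ultimately have "(\<Sum>i<m. infsum (?g i) B) \<le> infsum \<mu> B"
    by (intro tendsto_upperbound[of _ _ "finite_subsets_at_top B"]) simp_all
  moreover have "0 \<le> infsum \<mu> B" by (intro infsum_nonneg weight_nonneg)
  ultimately show "(\<Sum>i<m. \<bar>weighted_p_norm p \<mu> B (\<phi> i)\<bar> powr p) \<le> (infsum \<mu> B powr (1 / p)) powr p"
    using p by (simp add: weighted_p_norm_powr weighted_p_norm_nonneg powr_powr)
qed simp

lemma weighted_p_norm_in_ambient: "weighted_p_norm p \<mu> B \<in> fbl_ambient p"
  using weighted_p_norm_homogeneous weighted_p_norm_bound fbl_ambient_iff[OF p] by blast

lemma weighted_p_norm_Un:
  assumes "A \<inter> B = {}"
  shows "weighted_p_norm p \<mu> (A \<union> B) \<phi> = p_norm2 p (weighted_p_norm p \<mu> A \<phi>) (weighted_p_norm p \<mu> B \<phi>)"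
  unfolding p_norm2_def weighted_p_norm_powr
  unfolding weighted_p_norm_def infsum_Un_disjoint[OF weighted_powers_summable weighted_powers_summable assms] ..

text \<open>Adding one coordinate is one \<open>p\<close>-sum with a multiple of \<open>|\<delta>\<^sub>x|\<close> for \<open>x\<close> the unit vector.\<close>

lemma weighted_p_norm_finite_in_FBL:
  assumes "finite F"
  shows "weighted_p_norm p \<mu> F \<in> FBL p"
  using assms
proof (induction F rule: finite_induct)
  case empty
  have "weighted_p_norm p \<mu> {} = 0" by (simp add: fun_eq_iff weighted_p_norm_def)
  then show ?case using closed_sublatticeD(2)[OF closed_sublattice_FBL[OF p]] by (simp only:)
next
  case (insert a F)
  note FBL = closed_sublattice_FBL[OF p]
  have "sup (evaluation (unit_ell1 a)) (\<lambda>\<phi>. - 1 * evaluation (unit_ell1 a) \<phi>) \<in> FBL p"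
    by (intro closed_sublatticeD(4)[OF FBL] closed_sublatticeD(5)[OF FBL] evaluation_in_FBL)
  also have "sup (evaluation (unit_ell1 a)) (\<lambda>\<phi>. - 1 * evaluation (unit_ell1 a) \<phi>) =
      (\<lambda>\<phi>. \<bar>blinfun_apply \<phi> (unit_ell1 a)\<bar>)"
    by (auto simp: fun_eq_iff sup_real_def evaluation_def)
  finally have abs: "(\<lambda>\<phi>. \<bar>blinfun_apply \<phi> (unit_ell1 a)\<bar>) \<in> FBL p" .
  from closed_sublatticeD(5)[OF FBL abs, of "\<mu> a powr (1 / p)"]
  have "(\<lambda>\<phi>. \<mu> a powr (1 / p) * \<bar>blinfun_apply \<phi> (unit_ell1 a)\<bar>) \<in> FBL p" .
  moreover have "weighted_p_norm p \<mu> {a} = (\<lambda>\<phi>. \<mu> a powr (1 / p) * \<bar>blinfun_apply \<phi> (unit_ell1 a)\<bar>)"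
    using p by (simp add: fun_eq_iff weighted_p_norm_def powr_mult powr_powr weight_nonneg)
  ultimately have "weighted_p_norm p \<mu> {a} \<in> FBL p" by simp
  then have "(\<lambda>\<phi>. p_norm2 p (weighted_p_norm p \<mu> {a} \<phi>) (weighted_p_norm p \<mu> F \<phi>)) \<in> FBL p"
    using insert.IH by (intro closed_sublattice_p_norm2[OF p FBL]) (auto simp: le_fun_def weighted_p_norm_nonneg)
  moreover have "weighted_p_norm p \<mu> (insert a F) =
      (\<lambda>\<phi>. p_norm2 p (weighted_p_norm p \<mu> {a} \<phi>) (weighted_p_norm p \<mu> F \<phi>))"
    using weighted_p_norm_Un[of "{a}" F] insert.hyps by auto
  ultimately show ?case by simp
qed

text \<open>The difference to a finite partial sum is dominated by the tail, whose norm
  is controlled by the remaining mass of the weights.\<close>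

lemma weighted_p_norm_in_FBL: "weighted_p_norm p \<mu> UNIV \<in> FBL p"
proof (rule closed_sublattice_approximation[OF p closed_sublattice_FBL[OF p] weighted_p_norm_in_ambient])
  fix e :: real assume e: "0 < e"
  then obtain F where F: "finite F" "dist (sum \<mu> F) (infsum \<mu> UNIV) \<le> e powr p"
    using infsum_finite_approximation[OF weight_summable, of "e powr p" UNIV] by auto
  have "infsum \<mu> UNIV = sum \<mu> F + infsum \<mu> (- F)"
    using infsum_Un_disjoint[OF weight_summable weight_summable, of F "- F"] F(1) by simp
  with F(2) have tail: "infsum \<mu> (- F) \<le> e powr p" by (simp add: dist_real_def)
  have "\<bar>(weighted_p_norm p \<mu> F - weighted_p_norm p \<mu> UNIV) \<phi>\<bar> \<le> \<bar>weighted_p_norm p \<mu> (- F) \<phi>\<bar>" for \<phi>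
  proof -
    let ?s = "weighted_p_norm p \<mu> F \<phi>" and ?t = "weighted_p_norm p \<mu> (- F) \<phi>"
    have eq: "weighted_p_norm p \<mu> UNIV \<phi> = p_norm2 p ?s ?t"
      using weighted_p_norm_Un[of F "- F"] by simp
    have "?s = p_norm2 p ?s 0" using p by (simp add: p_norm2_def powr_powr weighted_p_norm_nonneg)
    also have "\<dots> \<le> p_norm2 p ?s ?t"
      unfolding p_norm2_def using p by (intro powr_mono2) auto
    finally show ?thesis
      using p_norm2_le_add[OF p weighted_p_norm_nonneg weighted_p_norm_nonneg, of F \<phi> "- F" \<phi>]
      by (simp add: eq abs_le_iff weighted_p_norm_nonneg)
  qed
  then have "fbl_bound p (infsum \<mu> (- F) powr (1 / p)) (weighted_p_norm p \<mu> F - weighted_p_norm p \<mu> UNIV)"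
    using p by (intro fbl_bound_mono[OF _ weighted_p_norm_bound]) auto
  from fbl_norm_le[OF p this]
  have "fbl_norm p (weighted_p_norm p \<mu> F - weighted_p_norm p \<mu> UNIV) \<le> infsum \<mu> (- F) powr (1 / p)" .
  also have "\<dots> \<le> e"
    using p e tail by (subst powr_inverse_le_iff) (auto intro: infsum_nonneg weight_nonneg)
  finally show "\<exists>h\<in>FBL p. fbl_norm p (h - weighted_p_norm p \<mu> UNIV) \<le> e"
    using weighted_p_norm_finite_in_FBL[OF F(1)] by blast
qed

end

lemma directed_finite_upper_bound:
  fixes D :: "'b::order set"
  assumes "D \<noteq> {}" "\<And>a b. a \<in> D \<Longrightarrow> b \<in> D \<Longrightarrow> \<exists>c\<in>D. a \<le> c \<and> b \<le> c" "finite B" "B \<subseteq> D"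
  shows "\<exists>c\<in>D. \<forall>b\<in>B. b \<le> c"
  using assms(3,4)
proof (induction B rule: finite_induct)
  case empty
  with assms(1) show ?case by auto
next
  case (insert b B)
  then obtain c where "c \<in> D" "\<forall>b\<in>B. b \<le> c" by auto
  moreover from this assms(2)[of b c] insert.prems obtain c' where "c' \<in> D" "b \<le> c'" "c \<le> c'" by auto
  ultimately show ?case by (intro bexI[of _ c']) auto
qed

text \<open>The weights are found by the minimax theorem for the differences of the two
  sides, one constraint for each triple \<open>(d, F, \<phi>)\<close>. For given non-negative
  multipliers \<open>l\<close> finitely many of the \<open>d\<close> are replaced by a common upper bound \<open>d0\<close>, the multipliers are absorbed into the
  functionals as \<open>l\<^sup>1\<^sup>/\<^sup>p\<close>, and the norm bound for \<open>d0\<close> shows that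
  the point mass at a coordinate where the weak norm of the resulting family is attained is a solution.\<close>

lemma directed_Pietsch_domination:
  fixes D :: "('a ell1 \<Rightarrow>\<^sub>L real \<Rightarrow> real) set"
  assumes p: "1 \<le> p" and C: "0 \<le> C"
    and D: "D \<noteq> {}" "D \<subseteq> fbl_ambient p" "\<And>d. d \<in> D \<Longrightarrow> 0 \<le> d" "\<And>d. d \<in> D \<Longrightarrow> fbl_norm p d \<le> C"
    and directed: "\<And>a b. a \<in> D \<Longrightarrow> b \<in> D \<Longrightarrow> \<exists>c\<in>D. a \<le> c \<and> b \<le> c"
  shows "\<exists>\<mu>\<in>subprobability_weights. \<forall>d\<in>D. \<forall>F \<phi>. finite F \<longrightarrow>
    d (restrict_functional F \<phi>) powr p \<le>
      C powr p * (\<Sum>a\<in>F. \<mu> a * \<bar>blinfun_apply \<phi> (unit_ell1 a)\<bar> powr p)"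
proof -
  define u where "u = (\<lambda>(d :: ('a ell1 \<Rightarrow>\<^sub>L real) \<Rightarrow> real, F, \<phi> :: 'a ell1 \<Rightarrow>\<^sub>L real) \<mu>.
    C powr p * (\<Sum>a\<in>F. \<mu> a * \<bar>blinfun_apply \<phi> (unit_ell1 a)\<bar> powr p) - d (restrict_functional F \<phi>) powr p)"
  define J where "J = {(d, F :: 'a set, \<phi> :: 'a ell1 \<Rightarrow>\<^sub>L real). d \<in> D \<and> finite F}"
  have "\<exists>\<mu>\<in>subprobability_weights. \<forall>j\<in>J. 0 \<le> u j \<mu>"
  proof (rule affine_minimax[OF compact_subprobability_weights])
    show "continuous_on UNIV (u j)" for j
      unfolding u_def split_beta by (intro continuous_intros continuous_on_product_coordinates)
  next
    fix x y :: "'a \<Rightarrow> real" and t :: real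
    assume xy: "x \<in> subprobability_weights" "y \<in> subprobability_weights" and t: "0 \<le> t" "t \<le> 1"
    let ?z = "\<lambda>a. (1 - t) * x a + t * y a"
    have "sum ?z F \<le> 1" if "finite F" for F
    proof -
      have "sum ?z F = (1 - t) * sum x F + t * sum y F" by (simp add: sum.distrib sum_distrib_left)
      also have "\<dots> \<le> (1 - t) * 1 + t * 1"
        using xy t that by (intro add_mono mult_left_mono) (auto simp: subprobability_weights_def)
      finally show ?thesis by simp
    qed
    then have "?z \<in> subprobability_weights"
      using xy t by (auto simp: subprobability_weights_def)
    moreover have "u j ?z = (1 - t) * u j x + t * u j y" for j
    proof -
      have "(\<Sum>a\<in>F. ?z a * g a) = (1 - t) * (\<Sum>a\<in>F. x a * g a) + t * (\<Sum>a\<in>F. y a * g a)" for F g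
        by (simp only: distrib_right sum.distrib sum_distrib_left mult.assoc)
      then show ?thesis by (simp only: u_def split_beta) (simp add: algebra_simps)
    qed
    ultimately show "\<exists>z\<in>subprobability_weights. \<forall>j\<in>J. u j z = (1 - t) * u j x + t * u j y" by blast
  next
    fix J' and l :: "((('a ell1 \<Rightarrow>\<^sub>L real) \<Rightarrow> real) \<times> 'a set \<times> ('a ell1 \<Rightarrow>\<^sub>L real)) \<Rightarrow> real"
    assume J': "finite J'" "J' \<subseteq> J" and l: "\<And>j. 0 \<le> l j"
    have "\<exists>d0\<in>D. \<forall>d\<in>fst ` J'. d \<le> d0"
      using J' by (intro directed_finite_upper_bound D directed) (auto simp: J_def)
    then obtain d0 where d0: "d0 \<in> D" and above: "\<And>j \<phi>. j \<in> J' \<Longrightarrow> fst j \<phi> \<le> d0 \<phi>"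
      by (auto simp: le_fun_def)
    have amb: "d0 \<in> fbl_ambient p" and hom: "positively_homogeneous d0"
      using d0 D(2) by (auto simp: fbl_ambient_def)
    have pos: "0 \<le> d \<phi>" if "d \<in> D" for d \<phi> using D(3)[OF that] by (simp add: le_fun_def)
    define \<psi> where "\<psi> j = restrict_functional (fst (snd j)) (snd (snd j))"
      for j :: "(('a ell1 \<Rightarrow>\<^sub>L real) \<Rightarrow> real) \<times> 'a set \<times> ('a ell1 \<Rightarrow>\<^sub>L real)"
    define \<theta> where "\<theta> j = l j powr (1 / p) *\<^sub>R \<psi> j" for j
    define h where "h a = (\<Sum>j\<in>J'. \<bar>blinfun_apply (\<theta> j) (unit_ell1 a)\<bar> powr p)" for a
    have fin: "finite (fst (snd j))" if "j \<in> J'" for j using J' that by (auto simp: J_def)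
    have \<theta>: "\<bar>blinfun_apply (\<theta> j) (unit_ell1 a)\<bar> powr p =
        l j * (if a \<in> fst (snd j) then \<bar>blinfun_apply (snd (snd j)) (unit_ell1 a)\<bar> powr p else 0)"
      if "j \<in> J'" for j a
      using l p by (simp add: \<theta>_def \<psi>_def scaleR_blinfun.rep_eq restrict_functional_unit[OF fin[OF that]]
        abs_mult powr_mult powr_powr)
    \<comment> \<open>A coordinate at which the weak \<open>p\<close>-norm of the scaled family is attained.\<close>
    obtain a0 where a0: "\<And>a. h a \<le> h a0"
    proof -
      have "h a \<in> insert 0 (h ` (\<Union>j\<in>J'. fst (snd j)))" for a
      proof (cases "a \<in> (\<Union>j\<in>J'. fst (snd j))")
        case False
        then have "h a = 0" unfolding h_def by (intro sum.neutral) (auto simp: \<theta>)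
        then show ?thesis by simp
      qed auto
      then have "finite (range h)"
        using J'(1) fin by (intro finite_subset[of "range h" "insert 0 (h ` (\<Union>j\<in>J'. fst (snd j)))"]) auto
      then have "Max (range h) \<in> range h" "\<And>a. h a \<le> Max (range h)" by (auto intro: Max_in)
      then show ?thesis using that by (metis imageE)
    qed
    let ?\<delta> = "\<lambda>a. if a = a0 then 1 else 0 :: real"
    have "(\<Sum>j\<in>J'. \<bar>d0 (\<theta> j)\<bar> powr p) \<le> fbl_norm p d0 powr p * h a0"
      using a0 by (intro fbl_bound_finite_family[OF p hom fbl_bound_norm[OF p amb] J'(1)]
        weak_p_bound_ell1[OF p]) (simp add: h_def)
    also have "\<dots> \<le> C powr p * h a0"
      using D(4)[OF d0] fbl_norm_nonneg[OF p amb] p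
      by (intro mult_right_mono powr_mono2) (auto simp: h_def sum_nonneg)
    finally have main: "(\<Sum>j\<in>J'. \<bar>d0 (\<theta> j)\<bar> powr p) \<le> C powr p * h a0" .
    have "l j * u j ?\<delta> \<ge> C powr p * \<bar>blinfun_apply (\<theta> j) (unit_ell1 a0)\<bar> powr p - \<bar>d0 (\<theta> j)\<bar> powr p"
      if j: "j \<in> J'" for j
    proof -
      have "\<bar>d0 (\<theta> j)\<bar> powr p = l j * d0 (\<psi> j) powr p"
        using hom l p pos[OF d0] by (simp add: \<theta>_def positively_homogeneous_def abs_mult powr_mult powr_powr)
      moreover have "l j * fst j (\<psi> j) powr p \<le> l j * d0 (\<psi> j) powr p"
      proof (intro mult_left_mono powr_mono2)
        show "0 \<le> fst j (\<psi> j)" using J' j by (intro pos) (auto simp: J_def)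
      qed (use p above[OF j] l in auto)
      moreover have "(\<Sum>a\<in>fst (snd j). ?\<delta> a * \<bar>blinfun_apply (snd (snd j)) (unit_ell1 a)\<bar> powr p) =
          (if a0 \<in> fst (snd j) then \<bar>blinfun_apply (snd (snd j)) (unit_ell1 a0)\<bar> powr p else 0)"
        using fin[OF j] by (simp add: if_distrib[of "\<lambda>x. x * _"] cong: if_cong)
      then have "l j * u j ?\<delta> = C powr p * \<bar>blinfun_apply (\<theta> j) (unit_ell1 a0)\<bar> powr p - l j * fst j (\<psi> j) powr p"
        unfolding \<theta>[OF j] by (simp add: u_def split_beta \<psi>_def right_diff_distrib mult.left_commute)
      ultimately show ?thesis by simp
    qed
    then have "(\<Sum>j\<in>J'. C powr p * \<bar>blinfun_apply (\<theta> j) (unit_ell1 a0)\<bar> powr p - \<bar>d0 (\<theta> j)\<bar> powr p)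
        \<le> (\<Sum>j\<in>J'. l j * u j ?\<delta>)"
      by (intro sum_mono)
    with main have "0 \<le> (\<Sum>j\<in>J'. l j * u j ?\<delta>)"
      by (simp add: sum_subtractf h_def flip: sum_distrib_left)
    moreover have "?\<delta> \<in> subprobability_weights"
      by (auto simp: subprobability_weights_def)
    ultimately show "\<exists>\<mu>\<in>subprobability_weights. 0 \<le> (\<Sum>j\<in>J'. l j * u j \<mu>)" by blast
  qed
  then show ?thesis by (force simp: J_def u_def)
qed

theorem theorem4p9:
  fixes p :: real
  assumes "1 \<le> p"
  shows "strong_nakano (FBL p :: ('a ell1 \<Rightarrow>\<^sub>L real \<Rightarrow> real) set) (fbl_norm p)"
  unfolding strong_nakano_def
proof (intro allI impI, elim conjE)
  fix D :: "('a ell1 \<Rightarrow>\<^sub>L real \<Rightarrow> real) set"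
  assume sub: "D \<subseteq> {a \<in> FBL p. 0 \<le> a}" and ne: "D \<noteq> {}"
    and directed: "\<forall>a\<in>D. \<forall>b\<in>D. \<exists>c\<in>D. a \<le> c \<and> b \<le> c"
    and bdd: "bdd_above (fbl_norm p ` D)"
  define C where "C = Sup (fbl_norm p ` D)"
  have D: "d \<in> FBL p" "d \<in> fbl_ambient p" "0 \<le> d" "fbl_norm p d \<le> C" if "d \<in> D" for d
  proof -
    show "d \<in> FBL p" "0 \<le> d" using that sub by blast+
    then show "d \<in> fbl_ambient p" using FBL_subset_ambient[OF assms] by blast
    show "fbl_norm p d \<le> C" unfolding C_def by (rule cSUP_upper[OF that bdd])
  qed
  have C: "0 \<le> C"
  proof -
    obtain d where "d \<in> D" using ne by blast
    with D[of d] fbl_norm_nonneg[OF assms, of d] show ?thesis by linarith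
  qed
  have "\<exists>\<mu>\<in>subprobability_weights. \<forall>d\<in>D. \<forall>F \<phi>. finite F \<longrightarrow>
    d (restrict_functional F \<phi>) powr p \<le>
      C powr p * (\<Sum>a\<in>F. \<mu> a * \<bar>blinfun_apply \<phi> (unit_ell1 a)\<bar> powr p)"
    using D directed by (intro directed_Pietsch_domination[OF assms C ne]) blast+
  then obtain \<mu> where \<mu>: "\<mu> \<in> subprobability_weights"
    and dom: "\<And>d F \<phi>. d \<in> D \<Longrightarrow> finite F \<Longrightarrow> d (restrict_functional F \<phi>) powr p \<le>
      C powr p * (\<Sum>a\<in>F. \<mu> a * \<bar>blinfun_apply \<phi> (unit_ell1 a)\<bar> powr p)"
    by blast
  define b where "b = (\<lambda>\<phi>. C * weighted_p_norm p \<mu> UNIV \<phi>)"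
  have b: "b \<in> FBL p"
    unfolding b_def
    by (intro closed_sublatticeD(5)[OF closed_sublattice_FBL] weighted_p_norm_in_FBL assms \<mu>)
  have "0 \<le> b" using C weighted_p_norm_nonneg[OF assms \<mu>] by (auto simp: b_def le_fun_def)
  have upper: "d \<le> b" if d: "d \<in> D" for d
  proof (rule le_funI)
    fix \<phi>
    have "d (restrict_functional F \<phi>) \<le> b \<phi>" if F: "finite F" for F
    proof (rule powr_le_powr_cancel[of p])
      have "d (restrict_functional F \<phi>) powr p \<le>
          C powr p * (\<Sum>a\<in>F. \<mu> a * \<bar>blinfun_apply \<phi> (unit_ell1 a)\<bar> powr p)"
        by (rule dom[OF d F])
      also have "\<dots> \<le> C powr p * (\<Sum>\<^sub>\<infinity>a. \<mu> a * \<bar>blinfun_apply \<phi> (unit_ell1 a)\<bar> powr p)"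
        using weight_nonneg[OF assms \<mu>] F
        by (intro mult_left_mono finite_sum_le_infsum weighted_powers_summable[OF assms \<mu>]) auto
      also have "\<dots> = b \<phi> powr p"
        using weighted_p_norm_powr[OF assms \<mu>, of UNIV \<phi>] by (simp add: b_def powr_mult)
      finally show "d (restrict_functional F \<phi>) powr p \<le> b \<phi> powr p" .
    qed (use assms \<open>0 \<le> b\<close> in \<open>auto simp: le_fun_def\<close>)
    then have "\<forall>\<^sub>F F in finite_subsets_at_top UNIV. d (restrict_functional F \<phi>) \<le> b \<phi>"
      by (rule eventually_finite_subsets_at_top_weakI)
    then show "d \<phi> \<le> b \<phi>"
      by (rule tendsto_upperbound[OF FBL_restrict_tendsto[OF assms D(1)[OF d]]]) simp
  qed
  have "fbl_norm p b = C"
  proof (rule antisym)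
    have "fbl_bound p (\<bar>C\<bar> * infsum \<mu> UNIV powr (1 / p)) b"
      unfolding b_def by (rule fbl_bound_cmult[OF weighted_p_norm_bound[OF assms \<mu>]])
    from fbl_norm_le[OF assms this] have "fbl_norm p b \<le> C * infsum \<mu> UNIV powr (1 / p)"
      using C by simp
    also have "\<dots> \<le> C"
    proof (intro mult_left_le C)
      show "infsum \<mu> UNIV powr (1 / p) \<le> 1"
        using assms infsum_weight_le_1[OF assms \<mu>, of UNIV]
        by (subst powr_inverse_le_iff) (auto intro: infsum_nonneg weight_nonneg[OF assms \<mu>])
    qed
    finally show "fbl_norm p b \<le> C" .
    have "fbl_norm p d \<le> fbl_norm p b" if d: "d \<in> D" for d
    proof (rule fbl_norm_le[OF assms], rule fbl_bound_mono)
      show "fbl_bound p (fbl_norm p b) b"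
        using b FBL_subset_ambient[OF assms] by (intro fbl_bound_norm assms) auto
      show "\<bar>d \<phi>\<bar> \<le> \<bar>b \<phi>\<bar>" for \<phi>
        using le_funD[OF upper[OF d], of \<phi>] le_funD[OF D(3)[OF d], of \<phi>] by simp
    qed (use assms in simp)
    then show "C \<le> fbl_norm p b" unfolding C_def using ne by (intro cSUP_least)
  qed
  with b \<open>0 \<le> b\<close> upper show "\<exists>b\<in>FBL p. 0 \<le> b \<and> (\<forall>a\<in>D. a \<le> b) \<and> fbl_norm p b = Sup (fbl_norm p ` D)"
    by (auto simp: C_def)
qed

end
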